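(* Let $c_0$ be the positive solution of the equation $c^2=e^{1/c^2}$, and let $\delta>\dfrac{6c_0^2+2}{3c_0^3}$. Let $f$ be a $2\pi$-periodic complex-valued function on $\mathbb{R}$, integrable on $(-\pi,\pi)$, and suppose there exists $C>0$ such that for all integers $k$ $$0<\left|\int_{-\pi}^{\pi}f(x)e^{-ikx}\,dx\right|\le Ce^{-\delta|k|}.$$ Then the system of successive derivatives $f(x),f'(x),f''(x),\dots$ is complete in the space $L_2(-\pi,\pi)$.
   Context: A system of vectors is complete in $L_2(-\pi,\pi)$ (complex-valued functions) if its linear span is dense in $L_2(-\pi,\pi)$. Functions are identified when equal almost everywhere; the exponential bound on the Fourier coefficients implies that $f$ coincides almost everywhere with a $2\pi$-periodic infinitely differentiable function, and $f$ is understood to be this function, so that its derivatives of all orders are defined. The equation $c^2=e^{1/c^2}$ has exactly one positive solution, $c_0=1.328\dots$, and $(6c_0^2+2)/(3c_0^3)=1.79\dots$. *)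

theory Defs
  imports "HOL-Analysis.Analysis"
begin

abbreviation period_measure :: "real measure" where
  "period_measure \<equiv> lebesgue_on {-pi<..<pi}"

text \<open>
  Elements of the space are represented by functions on the whole line; only their
  values on the interval matter, and functions equal almost everywhere there are at
  distance zero.
\<close>

definition L2_space :: "(real \<Rightarrow> complex) set" where
  "L2_space = {h. h \<in> borel_measurable period_measure \<and>
                  integrable period_measure (\<lambda>x. (norm (h x))\<^sup>2)}"

definition L2_norm :: "(real \<Rightarrow> complex) \<Rightarrow> real" where
  "L2_norm h = sqrt (LINT x|period_measure. (norm (h x))\<^sup>2)"

definition complex_span :: "(real \<Rightarrow> complex) set \<Rightarrow> (real \<Rightarrow> complex) set" where
  "complex_span S = {(\<lambda>x. \<Sum>u\<in>T. a u * u x) | T a. finite T \<and> T \<subseteq> S}"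

text \<open>
  Membership in the space is required explicitly, because the Bochner integral of a
  non-integrable function is zero.
\<close>

definition complete_in_L2 :: "(real \<Rightarrow> complex) set \<Rightarrow> bool" where
  "complete_in_L2 S \<longleftrightarrow> S \<subseteq> L2_space \<and>
     (\<forall>h\<in>L2_space. \<forall>\<epsilon>>0. \<exists>u\<in>complex_span S. L2_norm (\<lambda>x. h x - u x) < \<epsilon>)"

text \<open>
  The library's \<open>deriv\<close> is for functions from a field to itself, so derivatives of
  complex-valued functions of a real variable are vector derivatives.
\<close>

definition nth_derivative :: "nat \<Rightarrow> (real \<Rightarrow> complex) \<Rightarrow> real \<Rightarrow> complex" where
  "nth_derivative n g = ((\<lambda>h x. vector_derivative h (at x)) ^^ n) g"

definition infinitely_differentiable :: "(real \<Rightarrow> complex) \<Rightarrow> bool" where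
  "infinitely_differentiable g \<longleftrightarrow> (\<forall>n x. nth_derivative n g differentiable (at x))"

definition periodic_2pi :: "(real \<Rightarrow> complex) \<Rightarrow> bool" where
  "periodic_2pi g \<longleftrightarrow> (\<forall>x. g (x + 2 * pi) = g x)"

text \<open>
  There is at most one such \<open>g\<close> for a given \<open>f\<close>, since continuous functions that agree
  almost everywhere are equal.
\<close>

definition smooth_periodic_version :: "(real \<Rightarrow> complex) \<Rightarrow> (real \<Rightarrow> complex) \<Rightarrow> bool" where
  "smooth_periodic_version f g \<longleftrightarrow>
     periodic_2pi g \<and> infinitely_differentiable g \<and> (AE x in lebesgue. f x = g x)"

end

theory Submission
  imports Defs "HOL-Computational_Algebra.Polynomial"
begin

text \<open>
  With $a_k \neq 0$ the Fourier coefficients of $f$, the smooth version of $f$ is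
  $g(x) = \sum a_k e^{ikx}$, and $p(-i\,d/dx)\,g = \sum a_k\, p(k)\, e^{ikx}$ for every polynomial $p$.
  Since $|a_k| \le C e^{-\delta |k|}$, it suffices to approximate the function
  $k \mapsto [k = m]$ on the integers by polynomials with error at most
  $\varepsilon e^{\delta |k| / 2}$: then $a_m e^{imx}$ is a uniform limit of
  combinations of derivatives of $g$, and the trigonometric polynomials are dense in $L_2$.

  For small $s$ the Taylor polynomials of $e^{iks}$ converge in this weighted norm. Multiplying by
  the unimodular $e^{ikjs}$ and iterating gives $e^{ikjs}$ for every $j$; averaging over the $N$-th roots
  of unity gives the function $[N \mid k - m]$, which tends to $[k = m]$ as $N \to \infty$.
\<close>

subsection \<open>Trigonometric polynomials\<close>

text \<open>Only half of the decay rate is spent on the approximation: the error times |a_k| is then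
  still O(exp(-delta |k| / 2)), which is summable over the integers. The nonvanishing of a_m serves
  to pass from a_m e^{imx} to e^{imx}. The obstacle is the Taylor expansion. Its remainder is
  controlled by an exponential in |k| s, so against the weight exp(c |k|) it is small only for s up
  to a fixed multiple of c, whereas the roots of unity require frequencies up to 2 pi. A unimodular
  factor preserves every error bound, but it turns an approximating polynomial into a polynomial
  times e^{ikjs}; the iteration therefore carries all functions k^n e^{ikjs} at once, not just the
  pure exponentials. On the function space side, density in L_2 and uniqueness of Fourier
  coefficients in L_1 share one tool: indicators are L_1 limits of uniformly bounded trigonometric
  polynomials.\<close>

lemma complex_span_superset: "u \<in> S \<Longrightarrow> u \<in> complex_span S"
  unfolding complex_span_def
  by (rule CollectI, rule exI[of _ "{u}"], rule exI[of _ "\<lambda>_. 1"]) auto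

lemma complex_span_zero: "(\<lambda>x. 0) \<in> complex_span S"
  unfolding complex_span_def by (rule CollectI, rule exI[of _ "{}"]) auto

lemma complex_span_scale:
  assumes "u \<in> complex_span S"
  shows "(\<lambda>x. c * u x) \<in> complex_span S"
proof -
  obtain T a where T: "finite T" "T \<subseteq> S" "u = (\<lambda>x. \<Sum>v\<in>T. a v * v x)"
    using assms unfolding complex_span_def by auto
  have "(\<lambda>x. c * u x) = (\<lambda>x. \<Sum>v\<in>T. (c * a v) * v x)"
    by (simp add: T(3) sum_distrib_left mult.assoc)
  with T show ?thesis unfolding complex_span_def
    by (intro CollectI exI[of _ T] exI[of _ "\<lambda>v. c * a v"]) auto
qed

lemma complex_span_add:
  assumes "u \<in> complex_span S" "w \<in> complex_span S"
  shows "(\<lambda>x. u x + w x) \<in> complex_span S"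
proof -
  obtain T a where T: "finite T" "T \<subseteq> S" "u = (\<lambda>x. \<Sum>v\<in>T. a v * v x)"
    using assms(1) unfolding complex_span_def by auto
  obtain R b where R: "finite R" "R \<subseteq> S" "w = (\<lambda>x. \<Sum>v\<in>R. b v * v x)"
    using assms(2) unfolding complex_span_def by auto
  define c where "c v = (if v \<in> T then a v else 0) + (if v \<in> R then b v else 0)" for v
  have "u x = (\<Sum>v\<in>T \<union> R. (if v \<in> T then a v else 0) * v x)" for x
    unfolding T(3) using T(1) R(1) by (intro sum.mono_neutral_cong_left) auto
  moreover have "w x = (\<Sum>v\<in>T \<union> R. (if v \<in> R then b v else 0) * v x)" for x
    unfolding R(3) using T(1) R(1) by (intro sum.mono_neutral_cong_left) auto
  ultimately have "(\<lambda>x. u x + w x) = (\<lambda>x. \<Sum>v\<in>T \<union> R. c v * v x)"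
    by (simp add: c_def sum.distrib ring_distribs)
  with T R show ?thesis unfolding complex_span_def
    by (intro CollectI exI[of _ "T \<union> R"] exI[of _ c]) auto
qed

lemma complex_span_sum:
  assumes "\<And>i. i \<in> I \<Longrightarrow> u i \<in> complex_span S"
  shows "(\<lambda>x. \<Sum>i\<in>I. c i * u i x) \<in> complex_span S"
  using assms
proof (induction I rule: infinite_finite_induct)
  case (insert i I)
  then show ?case
    using complex_span_add[OF complex_span_scale[of "u i" S "c i"], of "\<lambda>x. \<Sum>i\<in>I. c i * u i x"]
    by simp
qed (simp_all add: complex_span_zero)

lemma complex_span_mult:
  assumes closed: "\<And>u w. u \<in> S \<Longrightarrow> w \<in> S \<Longrightarrow> (\<lambda>x. u x * w x) \<in> S"
    and "u \<in> complex_span S" "w \<in> complex_span S"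
  shows "(\<lambda>x. u x * w x) \<in> complex_span S"
proof -
  obtain T a where T: "finite T" "T \<subseteq> S" "u = (\<lambda>x. \<Sum>v\<in>T. a v * v x)"
    using assms(2) unfolding complex_span_def by auto
  obtain R b where R: "finite R" "R \<subseteq> S" "w = (\<lambda>x. \<Sum>v\<in>R. b v * v x)"
    using assms(3) unfolding complex_span_def by auto
  have "(\<lambda>x. u x * w x) = (\<lambda>x. \<Sum>v\<in>T. a v * (\<Sum>v'\<in>R. b v' * (v x * v' x)))"
    unfolding T(3) R(3)
    by (simp add: sum_product) (simp add: sum_distrib_left mult_ac)
  also have "\<dots> \<in> complex_span S"
    using T R closed by (intro complex_span_sum complex_span_superset) auto
  finally show ?thesis .
qed

abbreviation trig_polys :: "(real \<Rightarrow> complex) set" where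
  "trig_polys \<equiv> complex_span (range (\<lambda>k::int. \<lambda>x. cis (of_int k * x)))"

lemma cis_in_trig_polys: "(\<lambda>x. cis (of_int k * x)) \<in> trig_polys"
  by (intro complex_span_superset) auto

lemma const_in_trig_polys: "(\<lambda>x. c) \<in> trig_polys"
  using complex_span_scale[OF cis_in_trig_polys[of 0], of c] by simp

lemma trig_polys_mult:
  assumes "u \<in> trig_polys" "w \<in> trig_polys"
  shows "(\<lambda>x. u x * w x) \<in> trig_polys"
proof (rule complex_span_mult[OF _ assms])
  fix u w :: "real \<Rightarrow> complex"
  assume "u \<in> range (\<lambda>k::int. \<lambda>x. cis (of_int k * x))" "w \<in> range (\<lambda>k::int. \<lambda>x. cis (of_int k * x))"
  then obtain k l :: int where "u = (\<lambda>x. cis (of_int k * x))" "w = (\<lambda>x. cis (of_int l * x))" by auto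
  then have "(\<lambda>x. u x * w x) = (\<lambda>x. cis (of_int (k + l) * x))"
    by (auto simp: cis_mult ring_distribs)
  then show "(\<lambda>x. u x * w x) \<in> range (\<lambda>k::int. \<lambda>x. cis (of_int k * x))"
    by (rule range_eqI)
qed

lemma trig_polys_continuous:
  assumes "u \<in> trig_polys" shows "continuous_on UNIV u"
proof -
  obtain T a where T: "finite T" "T \<subseteq> range (\<lambda>k::int. \<lambda>x. cis (of_int k * x))"
      "u = (\<lambda>x. \<Sum>v\<in>T. a v * v x)"
    using assms unfolding complex_span_def by auto
  have "continuous_on UNIV (\<lambda>x. cis (of_int k * x))" for k :: int
    unfolding cis_conv_exp by (intro continuous_intros)
  with T(2) have "continuous_on UNIV v" if "v \<in> T" for v using that by auto
  then show ?thesis unfolding T(3) by (intro continuous_intros) auto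
qed

text \<open>Real polynomial functions on the plane are generated by real linear functionals and
  constants. On the circle a linear functional is a combination of cos and sin, which Euler's
  formulas express by the frequencies 1 and -1; sums and products stay inside because the
  trigonometric polynomials form an algebra.\<close>

lemma real_polynomial_cis_in_trig_polys:
  fixes q :: "complex \<Rightarrow> real"
  assumes "real_polynomial_function q"
  shows "(\<lambda>x. complex_of_real (q (cis x))) \<in> trig_polys"
  using assms
proof (induction q rule: real_polynomial_function.induct)
  case (linear f)
  have "f (cis x) = cos x * f 1 + sin x * f \<i>" for x
  proof -
    interpret bounded_linear f by fact
    have "f (cos x *\<^sub>R 1 + sin x *\<^sub>R \<i>) = cos x * f 1 + sin x * f \<i>" by (simp only: add scaleR real_scaleR_def)
    moreover have "cos x *\<^sub>R 1 + sin x *\<^sub>R \<i> = cis x" by (simp add: complex_eq_iff)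
    ultimately show ?thesis by simp
  qed
  moreover have "complex_of_real (cos x) = (cis (of_int 1 * x) + cis (of_int (-1) * x)) / 2"
       "complex_of_real (sin x) = (cis (of_int 1 * x) - cis (of_int (-1) * x)) / (2 * \<i>)" for x
    by (simp_all add: complex_eq_iff Re_divide Im_divide)
  ultimately have "(\<lambda>x. complex_of_real (f (cis x)))
     = (\<lambda>x. (of_real (f 1) / 2 + of_real (f \<i>) / (2 * \<i>)) * cis (of_int 1 * x)
          + (of_real (f 1) / 2 - of_real (f \<i>) / (2 * \<i>)) * cis (of_int (-1) * x))"
    by (intro ext, simp only: of_real_add of_real_mult) (simp add: field_simps)
  also have "\<dots> \<in> trig_polys"
    by (intro complex_span_add complex_span_scale cis_in_trig_polys)
  finally show ?case .
qed (simp_all add: const_in_trig_polys complex_span_add trig_polys_mult)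

text \<open>Posing the problem on the circle builds periodicity into the function and makes
  Stone-Weierstrass on a compact subset of the plane applicable.\<close>

lemma continuous_circle_trig_approx:
  fixes \<psi> :: "complex \<Rightarrow> complex"
  assumes "continuous_on (sphere 0 1) \<psi>" "0 < e"
  obtains u where "u \<in> trig_polys" "\<And>x. norm (\<psi> (cis x) - u x) < e"
proof -
  obtain p where p: "polynomial_function p" "\<And>z. z \<in> sphere 0 1 \<Longrightarrow> norm (\<psi> z - p z) < e"
    using Stone_Weierstrass_polynomial_function[OF compact_sphere assms] by blast
  have re: "real_polynomial_function (\<lambda>z. Re (p z))" "real_polynomial_function (\<lambda>z. Im (p z))"
    using p(1) bounded_linear_Re bounded_linear_Im unfolding polynomial_function_def o_def by blast+
  have "(\<lambda>x. p (cis x)) = (\<lambda>x. of_real (Re (p (cis x))) + \<i> * of_real (Im (p (cis x))))"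
    by (simp flip: complex_eq)
  also have "\<dots> \<in> trig_polys"
    by (intro complex_span_add complex_span_scale real_polynomial_cis_in_trig_polys re)
  finally show thesis using p(2) by (intro that) auto
qed

lemma inj_on_cis: "inj_on cis {-pi<..pi}"
proof (rule inj_onI)
  fix x y assume "x \<in> {-pi<..pi}" "y \<in> {-pi<..pi}" and eq: "cis x = cis y"
  then have "Arg (cis x) = x" "Arg (cis x) = y" unfolding atomize_conj
    by (intro conjI cis_Arg_unique) (simp_all only: sgn_cis greaterThanAtMost_iff)
  then show "x = y" by (rule trans[OF sym])
qed

section \<open>Lebesgue measure on one period and approximation of indicators\<close>

lemma measure_period:
  assumes "A \<subseteq> {-pi<..<pi}" shows "measure period_measure A = measure lebesgue A"
  using assms by (intro measure_restrict_space) auto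

lemma measure_period_space [simp]: "measure period_measure (space period_measure) = 2 * pi"
  by (subst measure_period) auto

lemma finite_period_measure: "finite_measure period_measure"
  by (rule finite_measureI) (auto simp: emeasure_restrict_space)

lemma integrable_period_bounded:
  fixes u :: "real \<Rightarrow> 'a::{banach,second_countable_topology}"
  assumes "u \<in> borel_measurable period_measure" "\<And>x. norm (u x) \<le> B"
  shows "integrable period_measure u"
  using finite_measure.integrable_const_bound[OF finite_period_measure _ assms(1)] assms(2) by auto

lemma continuous_period_measurable:
  fixes u :: "real \<Rightarrow> 'a::euclidean_space"
  assumes "continuous_on UNIV u" shows "u \<in> borel_measurable period_measure"
  using assms by (intro continuous_imp_measurable_on_sets_lebesgue) (auto intro: continuous_on_subset)

lemma sets_period: "E \<in> sets period_measure \<longleftrightarrow> E \<in> sets lebesgue \<and> E \<subseteq> {-pi<..<pi}"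
  by (auto simp: sets_restrict_space_iff)

text \<open>Regularity of the measure encloses \<open>E\<close> between a closed and an open set,
  Urysohn's lemma on the circle interpolates between them, and the interpolating function is
  uniformly close to a trigonometric polynomial. The bound 2, independent of \<open>E\<close> and
  \<open>e\<close>, is what later turns L_1 errors into L_2 errors and allows dominated
  convergence.\<close>

lemma indicator_trig_approx:
  assumes E: "E \<in> sets lebesgue" "E \<subseteq> {-pi<..<pi}" and "0 < e"
  obtains u where "u \<in> trig_polys" "\<And>x. norm (u x) \<le> 2"
    "(LINT x|period_measure. norm (indicator E x - u x)) < e"
proof -
  \<comment> \<open>The error is at most \<open>d\<close> from the exceptional set plus
    \<open>d\<close> times the length 2 pi of the period; 2 in place of 1 makes the final inequality
    strict.\<close>
  define d where "d = e / (2 + 2 * pi)"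
  have "d > 0" using \<open>0 < e\<close> by (simp add: d_def add_pos_pos)
  obtain K where K: "closed K" "K \<subseteq> E" "E - K \<in> lmeasurable" "emeasure lebesgue (E - K) < ennreal (d/2)"
    using sets_lebesgue_inner_closed[of E "d/2"] E \<open>d > 0\<close> by auto
  obtain U where U: "open U" "E \<subseteq> U" "U - E \<in> lmeasurable" "emeasure lebesgue (U - E) < ennreal (d/2)"
    using sets_lebesgue_outer_open[of E "d/2"] E \<open>d > 0\<close> by auto
  \<comment> \<open>Inside the period, \<open>D\<close> contains every point where the Urysohn
    function below can differ from the indicator of \<open>E\<close>.\<close>
  define D where "D = ((U - E) \<union> (E - K)) \<inter> {-pi<..<pi}"
  have D: "D \<in> lmeasurable" "D \<subseteq> {-pi<..<pi}"
    unfolding D_def using U K by (auto intro!: fmeasurable.Int lmeasurable_interval)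
  have "measure lebesgue D \<le> measure lebesgue ((U - E) \<union> (E - K))"
    unfolding D_def using U K by (intro measure_mono_fmeasurable sets.Int) (auto simp: fmeasurableD)
  also have "\<dots> \<le> measure lebesgue (U - E) + measure lebesgue (E - K)"
    using U K by (intro measure_Un_le) auto
  also have "\<dots> \<le> d/2 + d/2"
    using U(3,4) K(3,4) \<open>d > 0\<close>
    by (intro add_mono) (auto simp: emeasure_eq_measure2 ennreal_less_iff)
  finally have mD: "measure lebesgue D \<le> d" by simp
  have cis_cont: "continuous_on X cis" for X
    unfolding cis_conv_exp[abs_def] by (intro continuous_intros)
  have "bounded K" using K(2) E(2) bounded_subset[of "{-pi..pi}" K] by fastforce
  with K(1) have "compact K" by (simp add: compact_eq_bounded_closed)
  then have cK: "closed (cis ` K)" by (intro compact_imp_closed compact_continuous_image cis_cont)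
  \<comment> \<open>Cutting \<open>U\<close> down to the open period puts both endpoints into the
    complement, so the Urysohn function vanishes at the point where the circle is glued.\<close>
  have "compact ({-pi..pi} - (U \<inter> {-pi<..<pi}))" using U(1) by (intro compact_diff) auto
  then have cU: "closed (cis ` ({-pi..pi} - (U \<inter> {-pi<..<pi})))"
    by (intro compact_imp_closed compact_continuous_image cis_cont)
  \<comment> \<open>The endpoint -pi has the same image as pi, so it is replaced by pi before
    injectivity on the half-open interval is used.\<close>
  have cis_ne: "cis x \<noteq> cis y" if "x \<in> {-pi<..<pi}" "y \<in> {-pi..pi}" "x \<noteq> y" for x y
  proof (cases "y = -pi")
    case True
    then have "cis y = cis pi" by (simp add: complex_eq_iff)
    then show ?thesis using inj_onD[OF inj_on_cis, of x pi] that by auto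
  next
    case False
    then show ?thesis using inj_onD[OF inj_on_cis, of x y] that by auto
  qed
  have disj: "cis ` K \<inter> cis ` ({-pi..pi} - (U \<inter> {-pi<..<pi})) = {}"
    using K(2) E(2) U(2) cis_ne by blast
  obtain \<psi> :: "complex \<Rightarrow> complex" where \<psi>: "continuous_on UNIV \<psi>" "\<And>z. \<psi> z \<in> closed_segment 1 0"
      "\<And>z. z \<in> cis ` K \<Longrightarrow> \<psi> z = 1" "\<And>z. z \<in> cis ` ({-pi..pi} - (U \<inter> {-pi<..<pi})) \<Longrightarrow> \<psi> z = 0"
    using Urysohn[OF cK cU disj, of "1::complex" 0] by metis
  \<comment> \<open>The 1 in the minimum yields the bound 2, since the Urysohn function has modulus
    at most 1; the \<open>d\<close> yields the integral estimate.\<close>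
  obtain u where u: "u \<in> trig_polys" "\<And>x. norm (\<psi> (cis x) - u x) < min 1 d"
    using continuous_circle_trig_approx[OF continuous_on_subset[OF \<psi>(1) subset_UNIV], of "min 1 d"] \<open>d > 0\<close> by auto
  have seg: "norm z \<le> 1 \<and> norm (1 - z) \<le> 1" if z: "z \<in> closed_segment 1 (0::complex)" for z
  proof -
    obtain t where t: "0 \<le> t" "t \<le> 1" "z = of_real (1 - t)"
      using z unfolding closed_segment_def by (auto simp: scaleR_conv_of_real)
    then have "1 - z = of_real t" by simp
    with t show ?thesis by (simp only: norm_of_real) simp
  qed
  have un: "norm (u x) \<le> 2" for x
  proof -
    have "norm (u x) \<le> norm (\<psi> (cis x)) + norm (\<psi> (cis x) - u x)" by norm
    then show ?thesis using seg[OF \<psi>(2), of "cis x"] u(2)[of x] by linarith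
  qed
  have pt: "norm (indicator E x - u x) \<le> indicat_real D x + d" if "x \<in> {-pi<..<pi}" for x
  proof -
    have "norm (indicator E x - \<psi> (cis x)) \<le> indicat_real D x"
      using seg[OF \<psi>(2), of "cis x"] \<psi>(3)[of "cis x"] \<psi>(4)[of "cis x"] that K(2) U(2)
      by (auto simp: indicator_def D_def)
    moreover have "norm (indicator E x - u x) \<le> norm (indicator E x - \<psi> (cis x)) + norm (\<psi> (cis x) - u x)"
      by norm
    ultimately show ?thesis using u(2)[of x] by simp
  qed
  have um: "u \<in> borel_measurable period_measure"
    using continuous_period_measurable trig_polys_continuous[OF u(1)] .
  have Es: "E \<in> sets period_measure" and Ds: "D \<in> sets period_measure"
    using E D by (auto simp: sets_period)
  have iD: "integrable period_measure (\<lambda>x. indicat_real D x + d)"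
    using Ds by (intro integrable_period_bounded[of _ "1 + d"]) (auto simp: indicator_def \<open>d > 0\<close> less_imp_le)
  have iE: "integrable period_measure (\<lambda>x. norm (indicator E x - u x))"
  proof (rule integrable_period_bounded)
    show "norm (norm (indicator E x - u x)) \<le> 3" for x
      using norm_triangle_ineq4[of "indicator E x" "u x"] un[of x] by (auto simp: indicator_def split: if_splits)
  qed (use um Es in measurable)
  have "(LINT x|period_measure. norm (indicator E x - u x)) \<le> (LINT x|period_measure. indicat_real D x + d)"
    using pt by (intro integral_mono[OF iE iD]) auto
  also have "\<dots> = measure lebesgue D + d * (2 * pi)"
    using Ds D(2) finite_measure.emeasure_finite[OF finite_period_measure]
    by (subst Bochner_Integration.integral_add)
      (auto simp: measure_period Int_absorb2 less_top finite_measure.integrable_const[OF finite_period_measure]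
         intro!: integrable_real_indicator)
  also have "\<dots> \<le> d + d * (2 * pi)" using mD by simp
  also have "\<dots> < d * (2 + 2 * pi)" using \<open>d > 0\<close> by (simp add: algebra_simps)
  also have "\<dots> = e" using pi_gt_zero by (simp add: d_def) (use pi_gt_zero in linarith)
  finally show thesis using that u un by blast
qed

subsection \<open>Density of trigonometric polynomials and uniqueness of Fourier coefficients\<close>

text \<open>A substitute for Minkowski's inequality: density arguments tolerate a constant factor,
  which is paid for by taking a quarter of the allowed squared error in each part.\<close>

lemma cmod_add_squared_le: "(norm (a + b :: complex))\<^sup>2 \<le> 2 * (norm a)\<^sup>2 + 2 * (norm b)\<^sup>2"
proof -
  have "(norm (a + b))\<^sup>2 \<le> (norm a + norm b)\<^sup>2"
    by (intro power_mono norm_triangle_ineq) auto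
  also have "\<dots> \<le> 2 * (norm a)\<^sup>2 + 2 * (norm b)\<^sup>2"
    using sum_squares_bound[of "norm a" "norm b"] by (simp add: power2_sum)
  finally show ?thesis .
qed

lemma L2_space_add:
  assumes "a \<in> L2_space" "b \<in> L2_space"
  shows "(\<lambda>x. a x + b x) \<in> L2_space"
    and "(LINT x|period_measure. (norm (a x + b x))\<^sup>2)
      \<le> 2 * (LINT x|period_measure. (norm (a x))\<^sup>2) + 2 * (LINT x|period_measure. (norm (b x))\<^sup>2)"
proof -
  have m: "a \<in> borel_measurable period_measure" "b \<in> borel_measurable period_measure"
    and i: "integrable period_measure (\<lambda>x. (norm (a x))\<^sup>2)" "integrable period_measure (\<lambda>x. (norm (b x))\<^sup>2)"
    using assms by (auto simp: L2_space_def)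
  have i2: "integrable period_measure (\<lambda>x. 2 * (norm (a x))\<^sup>2 + 2 * (norm (b x))\<^sup>2)"
    using i by (intro Bochner_Integration.integrable_add integrable_mult_right) auto
  have i3: "integrable period_measure (\<lambda>x. (norm (a x + b x))\<^sup>2)"
    using m by (intro Bochner_Integration.integrable_bound[OF i2]) (auto intro: cmod_add_squared_le order_trans[OF _ abs_ge_self])
  show "(\<lambda>x. a x + b x) \<in> L2_space"
    using m i3 by (auto simp: L2_space_def)
  have "(LINT x|period_measure. (norm (a x + b x))\<^sup>2)
     \<le> (LINT x|period_measure. 2 * (norm (a x))\<^sup>2 + 2 * (norm (b x))\<^sup>2)"
    by (intro integral_mono i2 i3 cmod_add_squared_le)
  also have "\<dots> = 2 * (LINT x|period_measure. (norm (a x))\<^sup>2) + 2 * (LINT x|period_measure. (norm (b x))\<^sup>2)"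
    using i by (subst Bochner_Integration.integral_add) auto
  finally show "(LINT x|period_measure. (norm (a x + b x))\<^sup>2)
      \<le> 2 * (LINT x|period_measure. (norm (a x))\<^sup>2) + 2 * (LINT x|period_measure. (norm (b x))\<^sup>2)" .
qed

lemma L2_space_scale:
  assumes "a \<in> L2_space" shows "(\<lambda>x. c * a x) \<in> L2_space"
  using assms by (auto simp: L2_space_def norm_mult power_mult_distrib)

lemma L2_space_diff:
  assumes "a \<in> L2_space" "b \<in> L2_space" shows "(\<lambda>x. a x - b x) \<in> L2_space"
  using L2_space_add(1)[OF assms(1) L2_space_scale[OF assms(2), of "-1"]] by simp

lemma L2_space_bounded:
  assumes "u \<in> borel_measurable period_measure" "\<And>x. norm (u x) \<le> B"
  shows "u \<in> L2_space"
proof -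
  have "(norm (u x))\<^sup>2 \<le> B\<^sup>2" for x using assms(2) by (intro power_mono) auto
  then show ?thesis
    using assms(1) unfolding L2_space_def
    by (intro CollectI conjI integrable_period_bounded[of _ "B\<^sup>2"]) auto
qed

lemma trig_polys_L2:
  assumes "u \<in> trig_polys" shows "u \<in> L2_space"
proof -
  obtain T a where T: "finite T" "T \<subseteq> range (\<lambda>k::int. \<lambda>x. cis (of_int k * x))"
      "u = (\<lambda>x. \<Sum>v\<in>T. a v * v x)"
    using assms unfolding complex_span_def by auto
  show ?thesis
  proof (rule L2_space_bounded)
    fix x
    have "norm (u x) \<le> (\<Sum>v\<in>T. norm (a v * v x))" unfolding T(3) by (rule norm_sum)
    also have "\<dots> \<le> (\<Sum>v\<in>T. norm (a v))"
      using T(2) by (intro sum_mono) (auto simp: norm_mult)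
    finally show "norm (u x) \<le> (\<Sum>v\<in>T. norm (a v))" .
  qed (intro continuous_period_measurable trig_polys_continuous assms)
qed

text \<open>The L_2 closure of the trigonometric polynomials. Distances stay squared, so that no
  square roots intervene and the factor 2 bound acts as triangle inequality.\<close>

definition trig_closure :: "(real \<Rightarrow> complex) set" where
  "trig_closure = {h \<in> L2_space. \<forall>e>0. \<exists>u\<in>trig_polys.
     (LINT x|period_measure. (norm (h x - u x))\<^sup>2) < e}"

lemma trig_closure_add:
  assumes "h \<in> trig_closure" "k \<in> trig_closure"
  shows "(\<lambda>x. h x + k x) \<in> trig_closure"
  unfolding trig_closure_def
proof (intro CollectI conjI allI impI)
  have L: "h \<in> L2_space" "k \<in> L2_space" using assms by (auto simp: trig_closure_def)
  then show "(\<lambda>x. h x + k x) \<in> L2_space" by (rule L2_space_add)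
  fix e :: real assume "e > 0"
  then have "e / 4 > 0" by simp
  then obtain u v where u: "u \<in> trig_polys" "(LINT x|period_measure. (norm (h x - u x))\<^sup>2) < e / 4"
    and v: "v \<in> trig_polys" "(LINT x|period_measure. (norm (k x - v x))\<^sup>2) < e / 4"
    using assms unfolding trig_closure_def by blast
  have "(LINT x|period_measure. (norm ((h x - u x) + (k x - v x)))\<^sup>2) < e"
    using L2_space_add(2)[OF L2_space_diff[OF L(1) trig_polys_L2[OF u(1)]] L2_space_diff[OF L(2) trig_polys_L2[OF v(1)]]]
      u(2) v(2) by linarith
  moreover have "(h x - u x) + (k x - v x) = h x + k x - (u x + v x)" for x by simp
  ultimately show "\<exists>u\<in>trig_polys. (LINT x|period_measure. (norm (h x + k x - u x))\<^sup>2) < e"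
    using complex_span_add[OF u(1) v(1)] by (intro bexI[of _ "\<lambda>x. u x + v x"]) auto
qed

lemma trig_closure_scale:
  assumes "h \<in> trig_closure"
  shows "(\<lambda>x. c * h x) \<in> trig_closure"
  unfolding trig_closure_def
proof (intro CollectI conjI allI impI)
  have L: "h \<in> L2_space" using assms by (auto simp: trig_closure_def)
  then show "(\<lambda>x. c * h x) \<in> L2_space" by (rule L2_space_scale)
  fix e :: real assume "e > 0"
  have p: "(norm c)\<^sup>2 + 1 > 0" by (simp add: add_nonneg_pos)
  with \<open>e > 0\<close> have "e / ((norm c)\<^sup>2 + 1) > 0" by simp
  then obtain u where u: "u \<in> trig_polys" "(LINT x|period_measure. (norm (h x - u x))\<^sup>2) < e / ((norm c)\<^sup>2 + 1)"
    using assms unfolding trig_closure_def by blast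
  have "(LINT x|period_measure. (norm (c * h x - c * u x))\<^sup>2)
     = (norm c)\<^sup>2 * (LINT x|period_measure. (norm (h x - u x))\<^sup>2)"
    by (simp add: right_diff_distrib[symmetric] norm_mult power_mult_distrib)
  also have "\<dots> \<le> ((norm c)\<^sup>2 + 1) * (LINT x|period_measure. (norm (h x - u x))\<^sup>2)"
    by (intro mult_right_mono) auto
  also have "\<dots> < e" using u(2) p by (simp add: pos_less_divide_eq mult.commute)
  finally show "\<exists>u\<in>trig_polys. (LINT x|period_measure. (norm (c * h x - u x))\<^sup>2) < e"
    using complex_span_scale[OF u(1)] by (intro bexI[of _ "\<lambda>x. c * u x"]) auto
qed

lemma trig_closure_zero: "(\<lambda>x. 0) \<in> trig_closure"
  unfolding trig_closure_def using trig_polys_L2 complex_span_zero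
  by (auto intro!: bexI[of _ "\<lambda>x. 0"])

lemma trig_closure_sum:
  assumes "\<And>i. i \<in> I \<Longrightarrow> h i \<in> trig_closure"
  shows "(\<lambda>x. \<Sum>i\<in>I. c i * h i x) \<in> trig_closure"
  using assms
proof (induction I rule: infinite_finite_induct)
  case (insert i I)
  then show ?case
    using trig_closure_add[OF trig_closure_scale[of "h i" "c i"], of "\<lambda>x. \<Sum>i\<in>I. c i * h i x"]
    by simp
qed (simp_all add: trig_closure_zero)

text \<open>The difference between the indicator and its approximant has modulus at most 3, so its
  square is at most 3 times its modulus, and smallness in L_1 gives smallness in L_2.\<close>

lemma trig_closure_indicator:
  assumes "E \<in> sets period_measure"
  shows "indicator E \<in> trig_closure"
  unfolding trig_closure_def
proof (intro CollectI conjI allI impI)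
  show "indicator E \<in> L2_space"
  proof (rule L2_space_bounded)
    show "indicator E \<in> borel_measurable period_measure"
      using assms by (rule borel_measurable_indicator)
    show "norm (indicator E x :: complex) \<le> 1" for x by (cases "x \<in> E") simp_all
  qed
  fix e :: real assume "e > 0"
  then have e3: "e / 3 > 0" by simp
  have E: "E \<in> sets lebesgue" "E \<subseteq> {-pi<..<pi}" using assms by (simp_all only: sets_period)
  obtain u where u: "u \<in> trig_polys" "\<And>x. norm (u x) \<le> 2"
    "(LINT x|period_measure. norm (indicator E x - u x)) < e / 3"
    using indicator_trig_approx[OF E e3] by blast
  have b: "norm (indicator E x - u x) \<le> 3" for x
    using norm_triangle_ineq4[of "indicator E x" "u x"] u(2)[of x] by (auto simp: indicator_def split: if_splits)
  have um: "u \<in> borel_measurable period_measure"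
    using continuous_period_measurable trig_polys_continuous[OF u(1)] .
  have i: "integrable period_measure (\<lambda>x. 3 * norm (indicator E x - u x))"
    using um assms b by (intro integrable_period_bounded[of _ 9]) auto
  have "(LINT x|period_measure. (norm (indicator E x - u x))\<^sup>2) \<le> (LINT x|period_measure. 3 * norm (indicator E x - u x))"
  proof (rule integral_mono[OF _ i])
    show "(norm (indicator E x - u x))\<^sup>2 \<le> 3 * norm (indicator E x - u x)" for x
      using b[of x] by (simp add: power2_eq_square mult_right_mono)
    have "(norm (indicator E x - u x))\<^sup>2 \<le> 3\<^sup>2" for x using b[of x] by (intro power_mono) simp_all
    then show "integrable period_measure (\<lambda>x. (norm (indicator E x - u x))\<^sup>2)"
      using um assms by (intro integrable_period_bounded[of _ 9]) auto
  qed
  also have "\<dots> < e" using u(3) by simp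
  finally show "\<exists>u\<in>trig_polys. (LINT x|period_measure. (norm (indicator E x - u x))\<^sup>2) < e"
    using u(1) by blast
qed

lemma trig_closure_simple:
  assumes "simple_function period_measure s"
  obtains h where "h \<in> trig_closure" "\<And>x. x \<in> space period_measure \<Longrightarrow> h x = s x"
proof
  let ?S = "space period_measure"
  let ?h = "\<lambda>x. \<Sum>y\<in>s ` ?S. y * indicator (s -` {y} \<inter> ?S) x"
  show "?h \<in> trig_closure"
    using simple_functionD(2)[OF assms] by (intro trig_closure_sum trig_closure_indicator) auto
  fix x assume "x \<in> ?S"
  then have "?h x = (\<Sum>y\<in>s ` ?S. if y = s x then y else 0)"
    by (intro sum.cong) (auto simp: indicator_def)
  also have "\<dots> = s x" using simple_functionD(1)[OF assms] \<open>x \<in> ?S\<close> by (subst sum.delta) auto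
  finally show "?h x = s x" .
qed

text \<open>Indicators give simple functions by linearity, and simple functions dominated by a
  multiple of |h| approximate \<open>h\<close> in L_2 by dominated convergence.\<close>

lemma trig_polys_dense_L2:
  assumes h: "h \<in> L2_space" and "e > 0"
  obtains u where "u \<in> trig_polys" "(LINT x|period_measure. (norm (h x - u x))\<^sup>2) < e"
proof -
  have m: "h \<in> borel_measurable period_measure" and ih: "integrable period_measure (\<lambda>x. (norm (h x))\<^sup>2)"
    using h by (auto simp: L2_space_def)
  obtain s where s: "\<And>i. simple_function period_measure (s i)"
      "\<And>x. x \<in> space period_measure \<Longrightarrow> (\<lambda>i. s i x) \<longlonglongrightarrow> h x"
      "\<And>i x. x \<in> space period_measure \<Longrightarrow> norm (s i x) \<le> 2 * norm (h x)"
    using borel_measurable_implies_sequence_metric[OF m, of 0] unfolding dist_norm diff_0_right by blast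
  have sm: "s i \<in> borel_measurable period_measure" for i
    using s(1) by (rule borel_measurable_simple_function)
  have "(\<lambda>i. LINT x|period_measure. (norm (h x - s i x))\<^sup>2) \<longlonglongrightarrow> (LINT x|period_measure. 0)"
  proof (rule integral_dominated_convergence)
    \<comment> \<open>The simple functions satisfy |s_i| \<le> 2 |h|, so |h - s_i| \<le> 3 |h|, and
      9 is the square of 3.\<close>
    show "integrable period_measure (\<lambda>x. 9 * (norm (h x))\<^sup>2)" using ih by simp
    show "AE x in period_measure. (\<lambda>i. (norm (h x - s i x))\<^sup>2) \<longlonglongrightarrow> 0"
    proof (rule AE_I2)
      fix x assume "x \<in> space period_measure"
      then have "(\<lambda>i. (norm (h x - s i x))\<^sup>2) \<longlonglongrightarrow> (norm (h x - h x))\<^sup>2"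
        by (intro tendsto_intros s(2))
      then show "(\<lambda>i. (norm (h x - s i x))\<^sup>2) \<longlonglongrightarrow> 0" by simp
    qed
    show "AE x in period_measure. norm ((norm (h x - s i x))\<^sup>2) \<le> 9 * (norm (h x))\<^sup>2" for i
    proof (rule AE_I2)
      fix x assume "x \<in> space period_measure"
      then have "norm (h x - s i x) \<le> 3 * norm (h x)"
        using norm_triangle_ineq4[of "h x" "s i x"] s(3)[of x i] by linarith
      then have "(norm (h x - s i x))\<^sup>2 \<le> (3 * norm (h x))\<^sup>2" by (intro power_mono) auto
      then show "norm ((norm (h x - s i x))\<^sup>2) \<le> 9 * (norm (h x))\<^sup>2" by (simp add: power_mult_distrib)
    qed
  qed (use m sm in measurable)
  then have "(\<lambda>i. LINT x|period_measure. (norm (h x - s i x))\<^sup>2) \<longlonglongrightarrow> 0" by simp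
  from order_tendstoD(2)[OF this, of "e/4"] \<open>e > 0\<close>
  obtain i where i: "(LINT x|period_measure. (norm (h x - s i x))\<^sup>2) < e / 4"
    by (auto simp: eventually_sequentially)
  obtain k where k: "k \<in> trig_closure" "\<And>x. x \<in> space period_measure \<Longrightarrow> k x = s i x"
    using trig_closure_simple[OF s(1)[of i]] by blast
  have i': "(LINT x|period_measure. (norm (h x - k x))\<^sup>2) < e / 4"
    using i Bochner_Integration.integral_cong[OF refl, of period_measure "\<lambda>x. (norm (h x - k x))\<^sup>2" "\<lambda>x. (norm (h x - s i x))\<^sup>2"]
    by (simp only: k(2))
  have e4: "e / 4 > 0" using \<open>e > 0\<close> by simp
  have kL: "k \<in> L2_space" using k(1) by (simp add: trig_closure_def)
  obtain u where u: "u \<in> trig_polys" "(LINT x|period_measure. (norm (k x - u x))\<^sup>2) < e / 4"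
    using k(1) e4 unfolding trig_closure_def by blast
  have "(LINT x|period_measure. (norm ((h x - k x) + (k x - u x)))\<^sup>2) < e"
    using L2_space_add(2)[OF L2_space_diff[OF h kL] L2_space_diff[OF kL trig_polys_L2[OF u(1)]]] u(2) i'
    by linarith
  then show thesis using that u(1) by simp
qed

text \<open>Since \<open>F\<close> is merely integrable, L_2 density does not apply. Instead the
  integral of \<open>F\<close> over every measurable set is shown to vanish, by testing
  \<open>F\<close> against bounded trigonometric polynomials that tend to the indicator.\<close>

lemma Fourier_coeffs_zero_imp_AE_zero:
  fixes F :: "real \<Rightarrow> complex"
  assumes F: "integrable period_measure F"
    and zero: "\<And>k::int. (LINT x|period_measure. F x * cis (of_int k * x)) = 0"
  shows "AE x in period_measure. F x = 0"
proof (rule sigma_finite_measure.density_zero[OF _ F])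
  show "sigma_finite_measure period_measure"
    using finite_period_measure by (simp add: finite_measure_def)
  fix E assume E: "E \<in> sets period_measure"
  have Fm: "F \<in> borel_measurable period_measure" using F by auto
  have trig: "(LINT x|period_measure. F x * u x) = 0" if u: "u \<in> trig_polys" for u
  proof -
    obtain T a where T: "finite T" "T \<subseteq> range (\<lambda>k::int. \<lambda>x. cis (of_int k * x))"
        "u = (\<lambda>x. \<Sum>v\<in>T. a v * v x)"
      using u unfolding complex_span_def by auto
    have i: "integrable period_measure (\<lambda>x. F x * (a v * v x))" if vT: "v \<in> T" for v
    proof -
      obtain k :: int where v: "v = (\<lambda>x. cis (of_int k * x))" using T(2) vT by auto
      have "v \<in> borel_measurable period_measure"
        using cis_in_trig_polys[of k] unfolding v
        by (intro continuous_period_measurable trig_polys_continuous)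
      then have "integrable period_measure (\<lambda>x. F x * v x)"
        using Fm by (intro Bochner_Integration.integrable_bound[OF F]) (auto simp: v norm_mult)
      then have "integrable period_measure (\<lambda>x. a v * (F x * v x))" by simp
      then show ?thesis by (simp add: mult_ac)
    qed
    have "(LINT x|period_measure. F x * u x) = (\<Sum>v\<in>T. LINT x|period_measure. F x * (a v * v x))"
      unfolding T(3) sum_distrib_left using i by (intro Bochner_Integration.integral_sum) auto
    also have "\<dots> = (\<Sum>v\<in>T. a v * (LINT x|period_measure. F x * v x))"
      by (simp only: mult.left_commute[of "F x" "a v" for x v] Bochner_Integration.integral_mult_right_zero)
    also have "\<dots> = 0" using T(2) zero by (intro sum.neutral) auto
    finally show ?thesis .
  qed
  have E': "E \<in> sets lebesgue" "E \<subseteq> {-pi<..<pi}" using E by (simp_all only: sets_period)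
  have "\<exists>u. u \<in> trig_polys \<and> (\<forall>x. norm (u x) \<le> 2) \<and>
      (LINT x|period_measure. norm (indicator E x - u x)) < 1 / real (Suc n)" for n
  proof -
    have "1 / real (Suc n) > 0" by simp
    from indicator_trig_approx[OF E' this] show ?thesis by blast
  qed
  then obtain u where u: "\<And>n. u n \<in> trig_polys" "\<And>n x. norm (u n x) \<le> 2"
      "\<And>n. (LINT x|period_measure. norm (indicator E x - u n x)) < 1 / real (Suc n)"
    by metis
  have um: "u n \<in> borel_measurable period_measure" for n
    using continuous_period_measurable trig_polys_continuous[OF u(1)] .
  have "(\<lambda>n. LINT x|period_measure. norm (indicator E x - u n x)) \<longlonglongrightarrow> 0"
    using u(3) by (intro tendsto_sandwich[OF _ _ tendsto_const LIMSEQ_inverse_real_of_nat])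
      (auto simp: field_simps intro!: always_eventually less_imp_le)
  moreover have "integrable period_measure (\<lambda>x. indicator E x - u n x)" for n
  proof (rule integrable_period_bounded)
    show "norm (indicator E x - u n x) \<le> 3" for x
      using norm_triangle_ineq4[of "indicator E x" "u n x"] u(2)[of n x] by (auto simp: indicator_def split: if_splits)
  qed (use um E in measurable)
  \<comment> \<open>L_1 convergence cannot be multiplied by an unbounded \<open>F\<close>; along an
    almost everywhere convergent subsequence the products are dominated by 2 |F|.\<close>
  ultimately obtain r where r: "strict_mono r" "AE x in period_measure. (\<lambda>n. indicator E x - u (r n) x) \<longlonglongrightarrow> 0"
    using tendsto_L1_AE_subseq[of period_measure "\<lambda>n x. indicator E x - u n x"] by blast
  have "(\<lambda>n. LINT x|period_measure. F x * u (r n) x) \<longlonglongrightarrow> (LINT x|period_measure. F x * indicator E x)"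
  proof (rule integral_dominated_convergence)
    show "integrable period_measure (\<lambda>x. 2 * norm (F x))" using F by simp
    show "AE x in period_measure. (\<lambda>n. F x * u (r n) x) \<longlonglongrightarrow> F x * indicator E x"
      using r(2)
    proof eventually_elim
      case (elim x)
      from tendsto_diff[OF tendsto_const this] have "(\<lambda>n. indicator E x - (indicator E x - u (r n) x)) \<longlonglongrightarrow> indicator E x - 0" .
      then show ?case by (intro tendsto_mult) simp_all
    qed
    show "AE x in period_measure. norm (F x * u (r n) x) \<le> 2 * norm (F x)" for n
      using mult_left_mono[OF u(2) norm_ge_zero] by (intro AE_I2) (simp add: norm_mult mult.commute[of 2])
  qed (use Fm um E in measurable)
  then have "(LINT x|period_measure. F x * indicator E x) = 0"
    using trig[OF u(1)] by (simp add: LIMSEQ_const_iff)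
  moreover have "indicator E x *\<^sub>R F x = F x * indicator E x" for x by (cases "x \<in> E") simp_all
  ultimately show "set_lebesgue_integral period_measure E F = 0"
    by (simp add: set_lebesgue_integral_def)
qed

subsection \<open>Weighted polynomial approximation on the integers\<close>

lemma power_le_fact_exp:
  fixes x :: real assumes "0 \<le> x" shows "x ^ n \<le> fact n * exp x"
proof -
  have "(\<Sum>i\<in>{n}. x ^ i /\<^sub>R fact i) \<le> (\<Sum>i. x ^ i /\<^sub>R fact i)"
    using assms by (intro sum_le_suminf summable_exp_generic) auto
  then have "x ^ n / fact n \<le> exp x" by (simp add: exp_def field_simps)
  then show ?thesis by (simp add: field_simps)
qed

text \<open>The closure of the polynomials, restricted to the integers, in the supremum norm with
  weight exp(-c |k|).\<close>

definition poly_closure :: "real \<Rightarrow> (int \<Rightarrow> complex) set" where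
  "poly_closure c = {\<phi>. \<forall>e>0. \<exists>p. \<forall>k. norm (\<phi> k - poly p (of_int k)) \<le> e * exp (c * \<bar>of_int k\<bar>)}"

lemma poly_closureD:
  assumes "\<phi> \<in> poly_closure c" "e > 0"
  shows "\<exists>p. \<forall>k. norm (\<phi> k - poly p (of_int k)) \<le> e * exp (c * \<bar>of_int k\<bar>)"
  using assms by (simp add: poly_closure_def)

text \<open>Idempotence of the closure: approximants may themselves be limits of polynomials, which
  is what lets the frequency be raised step by step.\<close>

lemma poly_closure_closed:
  assumes "\<And>e. e > 0 \<Longrightarrow> \<exists>\<eta>\<in>poly_closure c. \<forall>k. norm (\<phi> k - \<eta> k) \<le> e * exp (c * \<bar>of_int k\<bar>)"
  shows "\<phi> \<in> poly_closure c"
  unfolding poly_closure_def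
proof (intro CollectI allI impI)
  fix e :: real assume "e > 0"
  then have e2: "e / 2 > 0" by simp
  obtain \<eta> where \<eta>: "\<eta> \<in> poly_closure c" "\<And>k. norm (\<phi> k - \<eta> k) \<le> e / 2 * exp (c * \<bar>of_int k\<bar>)"
    using assms[OF e2] by blast
  obtain p where p: "\<And>k. norm (\<eta> k - poly p (of_int k)) \<le> e / 2 * exp (c * \<bar>of_int k\<bar>)"
    using \<eta>(1) e2 unfolding poly_closure_def by blast
  have "norm (\<phi> k - poly p (of_int k)) \<le> e * exp (c * \<bar>of_int k\<bar>)" for k
  proof -
    have "norm (\<phi> k - poly p (of_int k)) \<le> norm (\<phi> k - \<eta> k) + norm (\<eta> k - poly p (of_int k))"
      by norm
    with \<eta>(2)[of k] p[of k] show ?thesis by simp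
  qed
  then show "\<exists>p. \<forall>k. norm (\<phi> k - poly p (of_int k)) \<le> e * exp (c * \<bar>of_int k\<bar>)" by blast
qed

lemma poly_in_poly_closure: "(\<lambda>k. poly p (of_int k)) \<in> poly_closure c"
  unfolding poly_closure_def by (auto intro!: exI[of _ p])

lemma poly_closure_add:
  assumes "\<phi> \<in> poly_closure c" "\<eta> \<in> poly_closure c"
  shows "(\<lambda>k. \<phi> k + \<eta> k) \<in> poly_closure c"
  unfolding poly_closure_def
proof (intro CollectI allI impI)
  fix e :: real assume "e > 0"
  then have e2: "e / 2 > 0" by simp
  obtain p where p: "\<And>k. norm (\<phi> k - poly p (of_int k)) \<le> e / 2 * exp (c * \<bar>of_int k\<bar>)"
    using assms(1) e2 unfolding poly_closure_def by blast
  obtain q where q: "\<And>k. norm (\<eta> k - poly q (of_int k)) \<le> e / 2 * exp (c * \<bar>of_int k\<bar>)"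
    using assms(2) e2 unfolding poly_closure_def by blast
  have "norm (\<phi> k + \<eta> k - poly (p + q) (of_int k)) \<le> e * exp (c * \<bar>of_int k\<bar>)" for k
  proof -
    have "norm (\<phi> k + \<eta> k - poly (p + q) (of_int k))
       = norm ((\<phi> k - poly p (of_int k)) + (\<eta> k - poly q (of_int k)))" by (simp add: algebra_simps)
    also have "\<dots> \<le> norm (\<phi> k - poly p (of_int k)) + norm (\<eta> k - poly q (of_int k))"
      by (rule norm_triangle_ineq)
    finally show ?thesis using p[of k] q[of k] by simp
  qed
  then show "\<exists>p. \<forall>k. norm (\<phi> k + \<eta> k - poly p (of_int k)) \<le> e * exp (c * \<bar>of_int k\<bar>)" by blast
qed

lemma poly_closure_scale:
  assumes "\<phi> \<in> poly_closure c"
  shows "(\<lambda>k. b * \<phi> k) \<in> poly_closure c"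
  unfolding poly_closure_def
proof (intro CollectI allI impI)
  fix e :: real assume "e > 0"
  have b: "norm b + 1 > 0" by (simp add: add_nonneg_pos)
  with \<open>e > 0\<close> have "e / (norm b + 1) > 0" by simp
  then obtain p where p: "\<And>k. norm (\<phi> k - poly p (of_int k)) \<le> e / (norm b + 1) * exp (c * \<bar>of_int k\<bar>)"
    using assms unfolding poly_closure_def by blast
  have "norm (b * \<phi> k - poly (smult b p) (of_int k)) \<le> e * exp (c * \<bar>of_int k\<bar>)" for k
  proof -
    have "norm (b * \<phi> k - poly (smult b p) (of_int k)) = norm b * norm (\<phi> k - poly p (of_int k))"
      by (simp flip: right_diff_distrib norm_mult)
    also have "\<dots> \<le> (norm b + 1) * (e / (norm b + 1) * exp (c * \<bar>of_int k\<bar>))"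
      using p by (intro mult_mono) auto
    also have "\<dots> = e * exp (c * \<bar>of_int k\<bar>)" using b by simp
    finally show ?thesis .
  qed
  then show "\<exists>p. \<forall>k. norm (b * \<phi> k - poly p (of_int k)) \<le> e * exp (c * \<bar>of_int k\<bar>)" by blast
qed

lemma poly_closure_sum:
  assumes "\<And>i. i \<in> I \<Longrightarrow> \<phi> i \<in> poly_closure c"
  shows "(\<lambda>k. \<Sum>i\<in>I. b i * \<phi> i k) \<in> poly_closure c"
  using assms
proof (induction I rule: infinite_finite_induct)
  case (insert i I)
  then show ?case
    using poly_closure_add[OF poly_closure_scale[of "\<phi> i" c "b i"], of "\<lambda>x. \<Sum>i\<in>I. b i * \<phi> i x"]
    by simp
qed (use poly_in_poly_closure[of 0] in simp_all)

text \<open>The weight exp(c |k|) is split in half. One half absorbs |k|^n, the other the factor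
  exp(3 |k| s) left by the Taylor remainder, whence s \<le> c / 6. What remains is (1/2)^M,
  uniformly in k.\<close>

lemma power_times_cis_in_poly_closure_small:
  assumes "c > 0" "0 \<le> s" "s \<le> c / 6"
  shows "(\<lambda>k. of_int k ^ n * cis (of_int k * s)) \<in> poly_closure c"
  unfolding poly_closure_def
proof (intro CollectI allI impI)
  fix e :: real assume "e > 0"
  \<comment> \<open>This is the constant in |k|^n \<le> K exp(c |k| / 2).\<close>
  define K where "K = fact n * (2 / c) ^ n"
  have "K > 0" using assms by (simp add: K_def)
  obtain M where M: "(1 / 2) ^ M < e / K"
    using real_arch_pow_inv[of "e / K" "1/2"] \<open>K > 0\<close> \<open>e > 0\<close> by auto
  define p where "p = (\<Sum>m\<le>M. monom ((\<i> * of_real s) ^ m / fact m) (n + m))"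
  have "norm (of_int k ^ n * cis (of_int k * s) - poly p (of_int k)) \<le> e * exp (c * \<bar>of_int k\<bar>)" for k :: int
  proof -
    define y where "y = \<bar>of_int k\<bar> * s"
    have y: "0 \<le> y" "3 * y \<le> c / 2 * \<bar>of_int k\<bar>"
      using assms mult_left_mono[of s "c / 6" "\<bar>of_int k\<bar>"] by (auto simp: y_def mult_ac)
    define z where "z = \<i> * of_real (of_int k * s)"
    have "poly p (of_int k) = of_int k ^ n * (\<Sum>m\<le>M. z ^ m / fact m)"
      by (simp add: p_def z_def poly_sum poly_monom sum_distrib_left power_mult_distrib power_add mult_ac)
    then have "norm (of_int k ^ n * cis (of_int k * s) - poly p (of_int k))
       = \<bar>of_int k\<bar> ^ n * norm (exp z - (\<Sum>m\<le>M. z ^ m / fact m))"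
      by (simp add: z_def cis_conv_exp norm_mult norm_power flip: right_diff_distrib)
    also have "\<dots> \<le> (K * exp (c / 2 * \<bar>of_int k\<bar>)) * ((1 / 2) ^ M * exp (3 * y))"
    proof (intro mult_mono)
      have "(c / 2 * \<bar>of_int k\<bar>) ^ n \<le> fact n * exp (c / 2 * \<bar>of_int k\<bar>)"
        using assms by (intro power_le_fact_exp) auto
      then show "\<bar>of_int k\<bar> ^ n \<le> K * exp (c / 2 * \<bar>of_int k\<bar>)"
        using assms by (simp add: K_def field_simps)
      \<comment> \<open>As \<open>z\<close> is purely imaginary, the exponential factor in the
        Taylor remainder is 1.\<close>
      have "norm (exp z - (\<Sum>m\<le>M. z ^ m / fact m)) \<le> y * (y ^ M / fact M)"
        using Taylor_exp[of z M] assms by (simp add: z_def y_def norm_mult abs_mult)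
      \<comment> \<open>Doubling \<open>y\<close> extracts the geometric factor at the price of
        exp(2 y) instead of exp(y); the extra factor \<open>y\<close> costs one more exp(y).\<close>
      also have "y ^ M / fact M = (1 / 2) ^ M * ((2 * y) ^ M / fact M)"
        by (simp add: power_mult_distrib power_divide)
      also have "(2 * y) ^ M / fact M \<le> exp (2 * y)"
        using power_le_fact_exp[of "2 * y" M] y(1) by (simp add: field_simps)
      also have "y * ((1 / 2) ^ M * exp (2 * y)) \<le> exp y * ((1 / 2) ^ M * exp (2 * y))"
      proof (rule mult_right_mono)
        show "y \<le> exp y" using exp_ge_add_one_self[of y] by linarith
      qed simp
      also have "\<dots> = (1 / 2) ^ M * exp (3 * y)"
        by (simp flip: exp_add)
      finally show "norm (exp z - (\<Sum>m\<le>M. z ^ m / fact m)) \<le> (1 / 2) ^ M * exp (3 * y)"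
        using y(1) by (simp add: mult_left_mono)
    qed (use \<open>K > 0\<close> in auto)
    also have "\<dots> = (K * (1 / 2) ^ M) * exp (c / 2 * \<bar>of_int k\<bar> + 3 * y)" by (simp add: exp_add)
    also have "\<dots> \<le> e * exp (c * \<bar>of_int k\<bar>)"
      using M \<open>K > 0\<close> \<open>e > 0\<close> y(2) by (intro mult_mono) (auto simp: field_simps)
    finally show ?thesis .
  qed
  then show "\<exists>p. \<forall>k. norm (of_int k ^ n * cis (of_int k * s) - poly p (of_int k)) \<le> e * exp (c * \<bar>of_int k\<bar>)"
    by blast
qed

text \<open>Multiplication by a bounded factor preserves the weighted bounds, so the step size
  of the Taylor estimate does not restrict the total frequency.\<close>

lemma power_times_cis_in_poly_closure:
  assumes "c > 0" "0 \<le> s" "s \<le> c / 6"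
  shows "(\<lambda>k. of_int k ^ n * cis (of_int k * (of_nat j * s))) \<in> poly_closure c"
proof (induction j arbitrary: n)
  case 0
  then show ?case using power_times_cis_in_poly_closure_small[of c 0 n] assms by simp
next
  case (Suc j)
  show ?case
  proof (rule poly_closure_closed)
    fix e :: real assume "e > 0"
    then obtain p where p: "\<And>k. norm (of_int k ^ n * cis (of_int k * s) - poly p (of_int k)) \<le> e * exp (c * \<bar>of_int k\<bar>)"
      using power_times_cis_in_poly_closure_small[OF assms, of n] unfolding poly_closure_def by blast
    \<comment> \<open>This is \<open>p\<close> times the exponential already reached, expanded into
      monomials. The induction hypothesis covers each of them because \<open>n\<close> is arbitrary
      there.\<close>
    let ?\<eta> = "\<lambda>k. \<Sum>m\<le>degree p. coeff p m * (of_int k ^ m * cis (of_int k * (of_nat j * s)))"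
    have "?\<eta> \<in> poly_closure c" using Suc.IH by (intro poly_closure_sum)
    moreover have "norm (of_int k ^ n * cis (of_int k * (of_nat (Suc j) * s)) - ?\<eta> k) \<le> e * exp (c * \<bar>of_int k\<bar>)" for k
    proof -
      have "?\<eta> k = cis (of_int k * (of_nat j * s)) * poly p (of_int k)"
        by (simp add: poly_altdef sum_distrib_left mult_ac)
      moreover have "cis (of_int k * (of_nat (Suc j) * s)) = cis (of_int k * (of_nat j * s)) * cis (of_int k * s)"
        by (simp add: cis_mult algebra_simps)
      ultimately have "of_int k ^ n * cis (of_int k * (of_nat (Suc j) * s)) - ?\<eta> k
         = cis (of_int k * (of_nat j * s)) * (of_int k ^ n * cis (of_int k * s) - poly p (of_int k))"
        by (simp add: algebra_simps)
      then show ?thesis using p[of k] by (simp add: norm_mult)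
    qed
    ultimately show "\<exists>\<eta>\<in>poly_closure c. \<forall>k. norm (of_int k ^ n * cis (of_int k * (of_nat (Suc j) * s)) - \<eta> k) \<le> e * exp (c * \<bar>of_int k\<bar>)"
      by (intro bexI[of _ ?\<eta>]) auto
  qed
qed

text \<open>A geometric sum whose ratio is an N-th root of unity; the ratio is not 1 because N
  cannot divide a nonzero integer of smaller modulus.\<close>

lemma sum_roots_of_unity:
  assumes "l \<noteq> 0" "\<bar>l\<bar> < int N"
  shows "(\<Sum>j<N. cis (of_int l * (of_nat j * (2 * pi / of_nat N)))) = 0"
proof -
  have N: "N > 0" using assms by auto
  define w where "w = cis (of_int l * (2 * pi / of_nat N))"
  have "cis (of_int l * (of_nat j * (2 * pi / of_nat N))) = w ^ j" for j
    unfolding w_def Complex.DeMoivre by (rule arg_cong[of _ _ cis]) simp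
  then have "(\<Sum>j<N. cis (of_int l * (of_nat j * (2 * pi / of_nat N)))) = (\<Sum>j<N. w ^ j)" by simp
  moreover have "w \<noteq> 1"
  proof
    assume "w = 1"
    then have "cos (of_int l * (2 * pi / of_nat N)) = 1" by (simp add: w_def complex_eq_iff)
    then obtain i :: int where "of_int l * (2 * pi / of_nat N) = of_int i * 2 * pi"
      by (auto simp: cos_one_2pi_int)
    then have "real_of_int l = of_int (i * int N)" using N by (simp add: field_simps)
    then have "l = i * int N" by linarith
    then have "int N dvd l" by simp
    then show False using assms zdvd_imp_le[of "int N" "\<bar>l\<bar>"] by auto
  qed
  moreover have "w ^ N = 1"
  proof -
    have "real N * (of_int l * (2 * pi / real N)) = 2 * pi * of_int l" using N by simp
    then show ?thesis by (simp only: w_def Complex.DeMoivre cis_multiple_2pi Ints_of_int)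
  qed
  ultimately show ?thesis by (simp add: geometric_sum)
qed

lemma delta_in_poly_closure:
  assumes "c > 0"
  shows "(\<lambda>k. if k = m then 1 else 0) \<in> poly_closure c"
proof (rule poly_closure_closed)
  fix e :: real assume "e > 0"
  \<comment> \<open>The first bound makes the step 2 pi / N at most c / 6. The second ensures e c
    |k| \<ge> 1 whenever |k - m| \<ge> N.\<close>
  obtain N :: nat where N: "real N \<ge> max (12 * pi / c) (\<bar>of_int m\<bar> + 1 / (e * c))"
    using real_arch_simple by blast
  have "12 * pi / c > 0" using assms by simp
  then have "N > 0" using N by (intro gr0I) auto
  define s where "s = 2 * pi / real N"
  have s: "0 \<le> s" "s \<le> c / 6" using N assms \<open>N > 0\<close> by (auto simp: s_def field_simps)
  \<comment> \<open>The average of the exponentials in k - m over the N-th roots of unity, with a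
    trivial zeroth power so that the summands have the form treated above.\<close>
  define \<eta> where "\<eta> k = (\<Sum>j<N. (cis (- (of_int m * (of_nat j * s))) / of_nat N) * (of_int k ^ 0 * cis (of_int k * (of_nat j * s))))" for k :: int
  have "\<eta> \<in> poly_closure c"
    unfolding \<eta>_def by (intro poly_closure_sum power_times_cis_in_poly_closure assms s)
  moreover have "norm ((if k = m then 1 else 0) - \<eta> k) \<le> e * exp (c * \<bar>of_int k\<bar>)" for k
  proof -
    have "\<eta> k = (\<Sum>j<N. cis (of_int (k - m) * (of_nat j * s))) / of_nat N"
      unfolding \<eta>_def sum_divide_distrib by (intro sum.cong) (auto simp: cis_mult algebra_simps)
    note \<eta> = this
    consider "k = m" | "k \<noteq> m" "\<bar>k - m\<bar> < int N" | "int N \<le> \<bar>k - m\<bar>" "k \<noteq> m" by linarith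
    then show ?thesis
    proof cases
      case 1
      then have "\<eta> k = 1" unfolding \<eta> using \<open>N > 0\<close> by simp
      with 1 show ?thesis using \<open>e > 0\<close> by simp
    next
      case 2
      then show ?thesis using sum_roots_of_unity[of "k - m" N] \<open>e > 0\<close> by (simp add: \<eta> s_def)
    next
      case 3
      \<comment> \<open>Far from \<open>m\<close> no cancellation is used: the average is at most 1,
        and the weight is already large enough to dominate it.\<close>
      have "norm (\<Sum>j<N. cis (of_int (k - m) * (of_nat j * s))) \<le> (\<Sum>j<N. norm (cis (of_int (k - m) * (of_nat j * s))))"
        by (rule norm_sum)
      then have "norm (\<eta> k) \<le> 1" using \<open>N > 0\<close> by (simp add: \<eta> norm_divide)
      also have "\<dots> \<le> e * exp (c * \<bar>of_int k\<bar>)"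
      proof -
        have "int N \<le> \<bar>k\<bar> + \<bar>m\<bar>" using 3 by linarith
        then have "real N \<le> \<bar>of_int k\<bar> + \<bar>of_int m\<bar>" by linarith
        with N have "1 / (e * c) \<le> \<bar>of_int k\<bar>" by linarith
        then have "1 \<le> e * (c * \<bar>of_int k\<bar>)" using \<open>e > 0\<close> assms by (simp add: field_simps)
        also have "\<dots> \<le> e * exp (c * \<bar>of_int k\<bar>)"
          using \<open>e > 0\<close> exp_ge_add_one_self[of "c * \<bar>of_int k\<bar>"] by (intro mult_left_mono) linarith+
        finally show ?thesis .
      qed
      finally show ?thesis using 3 by simp
    qed
  qed
  ultimately show "\<exists>\<eta>\<in>poly_closure c. \<forall>k. norm ((if k = m then 1 else 0) - \<eta> k) \<le> e * exp (c * \<bar>of_int k\<bar>)"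
    by blast
qed

subsection \<open>Trigonometric series with exponentially decaying coefficients\<close>

text \<open>The enumeration runs through 0, -1, 1, -2, 2, ..., so |k| grows like half the index, and
  exponential decay in |k| becomes comparison with a geometric series.\<close>

lemma abs_int_decode_ge: "real j \<le> 2 * \<bar>of_int (int_decode j)\<bar> + 1"
  by (cases "even j") (auto simp: int_decode_def sum_decode_def elim!: evenE oddE)

lemma summable_exp_int_decode:
  fixes c :: real assumes "c > 0"
  shows "summable (\<lambda>j. exp (- c * \<bar>of_int (int_decode j)\<bar>))"
proof (rule summable_comparison_test)
  show "summable (\<lambda>j. exp (c / 2) * exp (- c / 2) ^ j)"
    using assms by (intro summable_mult summable_geometric) auto
  have "exp (- c * \<bar>of_int (int_decode j)\<bar>) \<le> exp (c / 2) * exp (- c / 2) ^ j" for j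
  proof -
    have "c * real j \<le> c * (2 * \<bar>of_int (int_decode j)\<bar> + 1)"
      using assms abs_int_decode_ge by (intro mult_left_mono) auto
    then have "- c * \<bar>of_int (int_decode j)\<bar> \<le> c / 2 + real j * (- c / 2)" by (simp add: algebra_simps)
    then show ?thesis unfolding exp_of_nat_mult[symmetric] exp_add[symmetric] by simp
  qed
  then show "\<exists>N. \<forall>j\<ge>N. norm (exp (- c * \<bar>of_int (int_decode j)\<bar>)) \<le> exp (c / 2) * exp (- c / 2) ^ j"
    by auto
qed

text \<open>The termwise n-th derivative of the Fourier series. Enumerating the integers turns it
  into an ordinary series, whose absolute convergence makes the order immaterial.\<close>

definition trig_series :: "(int \<Rightarrow> complex) \<Rightarrow> nat \<Rightarrow> real \<Rightarrow> complex" where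
  "trig_series a n x =
     (\<Sum>j. a (int_decode j) * (\<i> * of_int (int_decode j)) ^ n * cis (of_int (int_decode j) * x))"

lemma cis_has_vector_derivative:
  "((\<lambda>x. cis (of_int k * x)) has_vector_derivative \<i> * of_int k * cis (of_int k * x)) (at x within S)"
  unfolding cis_conv_exp
  by (auto intro!: derivative_eq_intros has_vector_derivative_real_field simp: scaleR_conv_of_real)

lemma integral_cis:
  "(LINT x|period_measure. cis (of_int l * x)) = (if l = 0 then of_real (2 * pi) else 0)"
proof (cases "l = 0")
  case True
  have "(LINT x|period_measure. (1::complex)) = measure period_measure (space period_measure) *\<^sub>R 1"
    by (rule lebesgue_integral_const)
  with True show ?thesis by (simp only: measure_period_space) (simp add: scaleR_conv_of_real)
next
  case False
  define F where "F x = 1 / (\<i> * of_int l) * cis (of_int l * x)" for x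
  have "(F has_vector_derivative cis (of_int l * x)) (at x within {-pi..pi})" for x
    unfolding F_def using has_vector_derivative_mult_right[OF cis_has_vector_derivative[of l x "{-pi..pi}"], of "1 / (\<i> * of_int l)"] False
    by simp
  then have "((\<lambda>x. cis (of_int l * x)) has_integral F pi - F (-pi)) {-pi..pi}"
    by (intro fundamental_theorem_of_calculus) auto
  moreover have "F pi - F (-pi) = 0"
  proof -
    have "cis (of_int l * pi) = cis (of_int l * (-pi)) * cis (2 * pi * of_int l)"
      by (simp only: cis_mult) (simp add: algebra_simps)
    then show ?thesis by (simp add: F_def)
  qed
  ultimately have "((\<lambda>x. cis (of_int l * x)) has_integral 0) {-pi<..<pi}"
    by (simp add: has_integral_Icc_iff_Ioo)
  moreover have "integrable period_measure (\<lambda>x. cis (of_int l * x))"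
    by (intro integrable_period_bounded[of _ 1] continuous_period_measurable trig_polys_continuous
        cis_in_trig_polys) auto
  ultimately show ?thesis
    using False lebesgue_integral_eq_integral[of "{-pi<..<pi}" "\<lambda>x. cis (of_int l * x)"]
    by (simp add: integral_unique)
qed

context
  fixes a :: "int \<Rightarrow> complex" and C \<delta> :: real
  assumes \<delta>: "\<delta> > 0" and C: "\<And>k. norm (a k) \<le> C * exp (- \<delta> * \<bar>of_int k\<bar>)"
begin

lemma bound_nonneg: "0 \<le> C"
  using order_trans[OF norm_ge_zero C[of 0]] by simp

text \<open>Half of the decay absorbs the power |k|^n, the other half gives a convergent geometric
  majorant.\<close>

lemma summable_coeffs:
  "summable (\<lambda>j. norm (a (int_decode j) * (\<i> * of_int (int_decode j)) ^ n))"
proof (rule summable_comparison_test)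
  let ?K = "C * (fact n * (2 / \<delta>) ^ n)"
  show "summable (\<lambda>j. ?K * exp (- (\<delta> / 2) * \<bar>of_int (int_decode j)\<bar>))"
    using \<delta> by (intro summable_mult summable_exp_int_decode) auto
  have "norm (a k * (\<i> * of_int k) ^ n) \<le> ?K * exp (- (\<delta> / 2) * \<bar>of_int k\<bar>)" for k :: int
  proof -
    have "(\<delta> / 2 * \<bar>of_int k\<bar>) ^ n \<le> fact n * exp (\<delta> / 2 * \<bar>of_int k\<bar>)"
      using \<delta> by (intro power_le_fact_exp) auto
    then have "\<bar>of_int k\<bar> ^ n \<le> fact n * (2 / \<delta>) ^ n * exp (\<delta> / 2 * \<bar>of_int k\<bar>)"
      using \<delta> by (simp add: field_simps)
    moreover have "norm (a k * (\<i> * of_int k) ^ n) = norm (a k) * \<bar>of_int k\<bar> ^ n"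
      by (simp add: norm_mult norm_power)
    ultimately have "norm (a k * (\<i> * of_int k) ^ n)
      \<le> (C * exp (- \<delta> * \<bar>of_int k\<bar>)) * (fact n * (2 / \<delta>) ^ n * exp (\<delta> / 2 * \<bar>of_int k\<bar>))"
      using C[of k] bound_nonneg by (simp only:) (intro mult_mono, auto)
    also have "\<dots> = ?K * (exp (- \<delta> * \<bar>of_int k\<bar>) * exp (\<delta> / 2 * \<bar>of_int k\<bar>))" by (simp only: mult_ac)
    also have "exp (- \<delta> * \<bar>of_int k\<bar>) * exp (\<delta> / 2 * \<bar>of_int k\<bar>) = exp (- (\<delta> / 2) * \<bar>of_int k\<bar>)"
      by (simp add: algebra_simps flip: exp_add)
    finally show ?thesis .
  qed
  then show "\<exists>N. \<forall>j\<ge>N. norm (norm (a (int_decode j) * (\<i> * of_int (int_decode j)) ^ n))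
      \<le> ?K * exp (- (\<delta> / 2) * \<bar>of_int (int_decode j)\<bar>)" by auto
qed

lemma summable_norm_trig_series:
  "summable (\<lambda>j. norm (a (int_decode j) * (\<i> * of_int (int_decode j)) ^ n * cis (of_int (int_decode j) * x)))"
  using summable_coeffs[of n] by (simp add: norm_mult)

lemma trig_series_sums:
  "(\<lambda>j. a (int_decode j) * (\<i> * of_int (int_decode j)) ^ n * cis (of_int (int_decode j) * x)) sums trig_series a n x"
  unfolding trig_series_def by (intro summable_sums summable_norm_cancel[OF summable_norm_trig_series])

lemma norm_trig_series_le:
  "norm (trig_series a n x) \<le> (\<Sum>j. norm (a (int_decode j) * (\<i> * of_int (int_decode j)) ^ n))"
  using summable_norm[OF summable_norm_trig_series[of n x]]
  by (simp add: trig_series_def norm_mult)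

text \<open>Termwise differentiation is legitimate because the differentiated series converges
  uniformly by the Weierstrass M-test.\<close>

lemma trig_series_has_vector_derivative:
  "(trig_series a n has_vector_derivative trig_series a (Suc n) x) (at x)"
proof -
  let ?t = "\<lambda>n j x. a (int_decode j) * (\<i> * of_int (int_decode j)) ^ n * cis (of_int (int_decode j) * x)"
  have "\<exists>g. \<forall>x\<in>UNIV. (\<lambda>j. ?t n j x) sums g x \<and>
     (g has_derivative (\<lambda>h. h *\<^sub>R trig_series a (Suc n) x)) (at x within UNIV)"
  proof (rule has_derivative_series)
    fix j x
    have "(?t n j has_vector_derivative ?t (Suc n) j x) (at x)"
      using has_vector_derivative_mult_right[OF cis_has_vector_derivative[of "int_decode j" x UNIV],
          of "a (int_decode j) * (\<i> * of_int (int_decode j)) ^ n"]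
      by (simp add: mult_ac)
    then show "(?t n j has_derivative (\<lambda>h. h *\<^sub>R ?t (Suc n) j x)) (at x within UNIV)"
      by (simp add: has_vector_derivative_def)
  next
    fix e :: real assume "e > 0"
    have "uniform_limit UNIV (\<lambda>N x. \<Sum>j<N. ?t (Suc n) j x) (trig_series a (Suc n)) sequentially"
      unfolding trig_series_def[abs_def]
      by (rule Weierstrass_m_test[OF _ summable_coeffs[of "Suc n"]]) (simp add: norm_mult)
    from uniform_limitD[OF this \<open>e > 0\<close>]
    show "\<forall>\<^sub>F N in sequentially. \<forall>x\<in>UNIV. \<forall>h. norm ((\<Sum>j<N. h *\<^sub>R ?t (Suc n) j x) - h *\<^sub>R trig_series a (Suc n) x) \<le> e * norm h"
    proof eventually_elim
      case (elim N)
      show ?case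
      proof (intro ballI allI)
        fix x h
        have "norm ((\<Sum>j<N. h *\<^sub>R ?t (Suc n) j x) - h *\<^sub>R trig_series a (Suc n) x)
          = \<bar>h\<bar> * norm ((\<Sum>j<N. ?t (Suc n) j x) - trig_series a (Suc n) x)"
          by (simp only: scaleR_right.sum[symmetric] scaleR_right_diff_distrib[symmetric] norm_scaleR)
        also have "\<dots> \<le> \<bar>h\<bar> * e"
          using elim by (intro mult_left_mono) (auto simp: dist_norm less_imp_le)
        finally show "norm ((\<Sum>j<N. h *\<^sub>R ?t (Suc n) j x) - h *\<^sub>R trig_series a (Suc n) x) \<le> e * norm h"
          by (simp add: mult.commute)
      qed
    qed
  qed (use trig_series_sums in auto)
  then obtain g where g: "\<And>x. (\<lambda>j. ?t n j x) sums g x"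
      "\<And>x. (g has_derivative (\<lambda>h. h *\<^sub>R trig_series a (Suc n) x)) (at x)" by auto
  \<comment> \<open>The theorem on differentiating series yields only some sum function, which
    uniqueness of sums identifies.\<close>
  have "g = trig_series a n"
    using sums_unique2[OF g(1) trig_series_sums] by (intro ext)
  with g(2)[of x] show ?thesis by (simp add: has_vector_derivative_def)
qed

lemma nth_derivative_trig_series: "nth_derivative n (trig_series a 0) = trig_series a n"
  unfolding nth_derivative_def
  by (induction n) (auto simp: vector_derivative_at[OF trig_series_has_vector_derivative])

lemma trig_series_smooth: "infinitely_differentiable (trig_series a 0)"
  unfolding infinitely_differentiable_def nth_derivative_trig_series
  using trig_series_has_vector_derivative differentiableI_vector by blast

lemma trig_series_periodic: "periodic_2pi (trig_series a n)"
proof -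
  have "cis (of_int k * (x + 2 * pi)) = cis (of_int k * x)" for k :: int and x
  proof -
    have "cis (of_int k * (x + 2 * pi)) = cis (of_int k * x) * cis (2 * pi * of_int k)"
      by (simp only: cis_mult) (simp add: algebra_simps)
    then show ?thesis by simp
  qed
  then show ?thesis by (simp add: periodic_2pi_def trig_series_def)
qed

lemma trig_series_continuous: "continuous_on UNIV (trig_series a n)"
  by (intro continuous_at_imp_continuous_on ballI
      has_vector_derivative_continuous[OF trig_series_has_vector_derivative])

lemma trig_series_L2: "trig_series a n \<in> L2_space"
  by (rule L2_space_bounded[OF continuous_period_measurable[OF trig_series_continuous] norm_trig_series_le])

lemma derivative_span_approx_exponential:
  assumes "e > 0"
  obtains w where "w \<in> complex_span (range (trig_series a))" "\<And>x. norm (a m * cis (of_int m * x) - w x) \<le> e"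
proof -
  let ?k = "\<lambda>j. int_decode j" and ?S = "\<Sum>j. exp (- (\<delta> / 2) * \<bar>of_int (int_decode j)\<bar>)"
  have sS: "summable (\<lambda>j. exp (- (\<delta> / 2) * \<bar>of_int (int_decode j)\<bar>))"
    using \<delta> by (intro summable_exp_int_decode) auto
  have S: "?S \<ge> 0" by (intro suminf_nonneg sS) auto
  \<comment> \<open>The error series will sum to at most C d S; adding 1 keeps the denominator
    positive even if C = 0.\<close>
  define d where "d = e / (C * ?S + 1)"
  have p1: "C * ?S + 1 > 0" using S bound_nonneg by (intro add_nonneg_pos mult_nonneg_nonneg) auto
  then have "d > 0" using assms by (simp add: d_def)
  have "\<delta> / 2 > 0" using \<delta> by simp
  from delta_in_poly_closure[OF this, of m] obtain p where
    p: "\<And>k. norm ((if k = m then 1 else 0) - poly p (complex_of_int k)) \<le> d * exp (\<delta> / 2 * \<bar>of_int k\<bar>)"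
    using poly_closureD[OF _ \<open>d > 0\<close>] by blast
  \<comment> \<open>Dividing by powers of the imaginary unit cancels those produced by
    differentiation, so the k-th coefficient is multiplied by exactly p(k).\<close>
  define w where "w x = (\<Sum>n\<le>degree p. (coeff p n / \<i> ^ n) * trig_series a n x)" for x
  have "w \<in> complex_span (range (trig_series a))"
    unfolding w_def by (intro complex_span_sum complex_span_superset) auto
  moreover have "norm (a m * cis (of_int m * x) - w x) \<le> e" for x
  proof -
    let ?d = "\<lambda>j. ((if ?k j = m then 1 else 0) - poly p (of_int (?k j))) * a (?k j) * cis (of_int (?k j) * x)"
    have "(\<lambda>j. \<Sum>n\<le>degree p. (coeff p n / \<i> ^ n) * (a (?k j) * (\<i> * of_int (?k j)) ^ n * cis (of_int (?k j) * x))) sums w x"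
      unfolding w_def by (intro sums_sum sums_mult trig_series_sums)
    moreover have "(\<Sum>n\<le>degree p. (coeff p n / \<i> ^ n) * (a (?k j) * (\<i> * of_int (?k j)) ^ n * cis (of_int (?k j) * x)))
       = poly p (of_int (?k j)) * a (?k j) * cis (of_int (?k j) * x)" for j
      unfolding poly_altdef sum_distrib_right
      by (intro sum.cong refl) (simp add: power_mult_distrib)
    ultimately have w: "(\<lambda>j. poly p (of_int (?k j)) * a (?k j) * cis (of_int (?k j) * x)) sums w x" by simp
    have "(\<lambda>j. if j = int_encode m then a (?k j) * cis (of_int (?k j) * x) else 0) sums
       (a (?k (int_encode m)) * cis (of_int (?k (int_encode m)) * x))"
      by (rule sums_single)
    moreover have "j = int_encode m \<longleftrightarrow> ?k j = m" for j
      by (metis int_decode_inverse int_encode_inverse)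
    ultimately have "(\<lambda>j. if ?k j = m then a (?k j) * cis (of_int (?k j) * x) else 0) sums (a m * cis (of_int m * x))"
      by simp
    from sums_diff[OF this w] have s: "?d sums (a m * cis (of_int m * x) - w x)"
      by (rule back_subst[of "\<lambda>f. f sums _"]) (auto simp: algebra_simps)
    have le: "norm (?d j) \<le> (C * d) * exp (- (\<delta> / 2) * \<bar>of_int (?k j)\<bar>)" for j
    proof -
      have "norm (?d j) = norm ((if ?k j = m then 1 else 0) - poly p (of_int (?k j))) * norm (a (?k j))"
        by (simp add: norm_mult)
      also have "\<dots> \<le> (d * exp (\<delta> / 2 * \<bar>of_int (?k j)\<bar>)) * (C * exp (- \<delta> * \<bar>of_int (?k j)\<bar>))"
        using p C \<open>d > 0\<close> by (intro mult_mono) auto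
      also have "\<dots> = (C * d) * (exp (\<delta> / 2 * \<bar>of_int (?k j)\<bar>) * exp (- \<delta> * \<bar>of_int (?k j)\<bar>))"
        by (simp only: mult_ac)
      also have "exp (\<delta> / 2 * \<bar>of_int (?k j)\<bar>) * exp (- \<delta> * \<bar>of_int (?k j)\<bar>) = exp (- (\<delta> / 2) * \<bar>of_int (?k j)\<bar>)"
        by (simp add: algebra_simps flip: exp_add)
      finally show ?thesis .
    qed
    have "norm (a m * cis (of_int m * x) - w x) \<le> (\<Sum>j. (C * d) * exp (- (\<delta> / 2) * \<bar>of_int (?k j)\<bar>))"
      unfolding sums_unique[OF s] by (intro norm_suminf_le summable_mult sS le)
    also have "\<dots> = C * d * ?S" by (rule suminf_mult[OF sS])
    also have "\<dots> \<le> d * (C * ?S + 1)" using \<open>d > 0\<close> by (simp add: algebra_simps)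
    also have "\<dots> = e" using p1 by (simp add: d_def)
    finally show ?thesis .
  qed
  ultimately show thesis by (rule that)
qed

text \<open>Absolute summability of the coefficients permits integration term by term, and
  orthogonality leaves the single index that encodes \<open>k\<close>.\<close>

lemma trig_series_Fourier_coeff:
  "(LINT x|period_measure. trig_series a 0 x * cis (- of_int k * x)) = 2 * pi * a k"
proof -
  let ?f = "\<lambda>j x. a (int_decode j) * cis (of_int (int_decode j - k) * x)"
  have int: "integrable period_measure (?f j)" for j
    by (intro integrable_mult_right integrable_period_bounded[of _ 1] continuous_period_measurable
        trig_polys_continuous cis_in_trig_polys) auto
  have "(\<lambda>j. LINT x|period_measure. ?f j x) sums (LINT x|period_measure. (\<Sum>j. ?f j x))"
  proof (rule sums_integral[OF int])
    show "AE x in period_measure. summable (\<lambda>j. norm (?f j x))"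
      using summable_coeffs[of 0] by (simp add: norm_mult)
    have "(LINT x|period_measure. norm (?f j x)) = norm (a (int_decode j)) * (2 * pi)" for j
      using lebesgue_integral_const[of period_measure "norm (a (int_decode j))"]
      by (simp only: norm_mult norm_cis measure_period_space) (simp add: mult.commute)
    then show "summable (\<lambda>j. LINT x|period_measure. norm (?f j x))"
      using summable_mult2[OF summable_coeffs[of 0], of "2 * pi"] by simp
  qed
  moreover have "(\<Sum>j. ?f j x) = trig_series a 0 x * cis (- of_int k * x)" for x
    using sums_mult2[OF trig_series_sums[of 0 x], of "cis (- of_int k * x)"]
    by (intro sums_unique[symmetric]) (simp add: cis_mult algebra_simps)
  moreover have "(LINT x|period_measure. ?f j x) = (if j = int_encode k then 2 * pi * a (int_decode j) else 0)" for j
  proof -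
    have A: "(LINT x|period_measure. ?f j x) = a (int_decode j) * (if int_decode j - k = 0 then of_real (2 * pi) else 0)"
      by (simp only: Bochner_Integration.integral_mult_right_zero integral_cis)
    have B: "int_decode j - k = 0 \<longleftrightarrow> j = int_encode k"
      by (metis eq_iff_diff_eq_0 int_decode_inverse int_encode_inverse)
    show ?thesis unfolding A B by simp
  qed
  ultimately have "(\<lambda>j. if j = int_encode k then 2 * pi * a (int_decode j) else 0) sums
      (LINT x|period_measure. trig_series a 0 x * cis (- of_int k * x))" by simp
  from sums_unique2[OF this sums_single] show ?thesis by simp
qed

end

section \<open>From approximation of exponentials to completeness\<close>

lemma trig_poly_uniform_approx:
  assumes exp: "\<And>m e. e > 0 \<Longrightarrow> \<exists>w\<in>complex_span S. \<forall>x. norm (cis (of_int m * x) - w x) \<le> e"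
    and u: "u \<in> trig_polys" and "e > 0"
  obtains w where "w \<in> complex_span S" "\<And>x. norm (u x - w x) \<le> e"
proof -
  obtain T b where T: "finite T" "T \<subseteq> range (\<lambda>k::int. \<lambda>x. cis (of_int k * x))"
      "u = (\<lambda>x. \<Sum>v\<in>T. b v * v x)"
    using u unfolding complex_span_def by auto
  define d where "d = e / ((\<Sum>v\<in>T. norm (b v)) + 1)"
  have pos: "(\<Sum>v\<in>T. norm (b v)) + 1 > 0" by (intro add_nonneg_pos sum_nonneg) auto
  with \<open>e > 0\<close> have "d > 0" by (simp add: d_def)
  have "\<exists>w. w \<in> complex_span S \<and> (\<forall>x. norm (v x - w x) \<le> d)" if "v \<in> T" for v
    using T(2) that exp[OF \<open>d > 0\<close>] by blast
  then obtain w where w: "\<And>v. v \<in> T \<Longrightarrow> w v \<in> complex_span S"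
      "\<And>v x. v \<in> T \<Longrightarrow> norm (v x - w v x) \<le> d" by metis
  show thesis
  proof
    show "(\<lambda>x. \<Sum>v\<in>T. b v * w v x) \<in> complex_span S" by (intro complex_span_sum w)
    fix x
    have "norm (u x - (\<Sum>v\<in>T. b v * w v x)) = norm (\<Sum>v\<in>T. b v * (v x - w v x))"
      by (simp add: T(3) right_diff_distrib sum_subtractf)
    also have "\<dots> \<le> (\<Sum>v\<in>T. norm (b v) * d)"
      using w(2) by (intro sum_norm_le) (simp add: norm_mult mult_left_mono)
    also have "\<dots> \<le> d * ((\<Sum>v\<in>T. norm (b v)) + 1)"
      using \<open>d > 0\<close> unfolding sum_distrib_right[symmetric] by (simp add: algebra_simps)
    also have "\<dots> = e" using pos by (simp add: d_def)
    finally show "norm (u x - (\<Sum>v\<in>T. b v * w v x)) \<le> e" .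
  qed
qed

lemma complete_in_L2_if_approx_exponentials:
  assumes S: "S \<subseteq> L2_space" "\<And>v. v \<in> S \<Longrightarrow> continuous_on UNIV v"
    and exp: "\<And>m e. e > 0 \<Longrightarrow> \<exists>w\<in>complex_span S. \<forall>x. norm (cis (of_int m * x) - w x) \<le> e"
  shows "complete_in_L2 S"
  unfolding complete_in_L2_def
proof (intro conjI S(1) ballI allI impI)
  fix h and e :: real assume h: "h \<in> L2_space" and "e > 0"
  then have "e\<^sup>2 / 4 > 0" by simp
  from trig_polys_dense_L2[OF h this] obtain u where
    u: "u \<in> trig_polys" "(LINT x|period_measure. (norm (h x - u x))\<^sup>2) < e\<^sup>2 / 4" by blast
  \<comment> \<open>A uniform error \<open>d\<close> contributes 2 pi d^2 < 8 d^2 = 2 e^2 / 9, below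
    the admissible quarter of e^2.\<close>
  define d where "d = e / 6"
  have "d > 0" using \<open>e > 0\<close> by (simp add: d_def)
  from trig_poly_uniform_approx[OF exp u(1) this] obtain w where
    w: "w \<in> complex_span S" "\<And>x. norm (u x - w x) \<le> d" by blast
  have "continuous_on UNIV w"
  proof -
    obtain T b where "finite T" "T \<subseteq> S" "w = (\<lambda>x. \<Sum>v\<in>T. b v * v x)"
      using w(1) unfolding complex_span_def by auto
    then show ?thesis using S(2) by (auto intro!: continuous_intros)
  qed
  then have m: "(\<lambda>x. u x - w x) \<in> borel_measurable period_measure"
    using trig_polys_continuous[OF u(1)] by (intro continuous_period_measurable continuous_on_diff)
  have uw: "(\<lambda>x. u x - w x) \<in> L2_space" by (rule L2_space_bounded[OF m w(2)])
  have "(LINT x|period_measure. (norm (u x - w x))\<^sup>2) \<le> (LINT x|period_measure. d\<^sup>2)"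
    using uw w(2) \<open>d > 0\<close>
    by (intro integral_mono finite_measure.integrable_const finite_period_measure power_mono)
      (auto simp: L2_space_def)
  also have "\<dots> = 2 * pi * d\<^sup>2"
    using lebesgue_integral_const[of period_measure "d\<^sup>2"] by (simp only: measure_period_space) simp
  also have "\<dots> < 8 * d\<^sup>2" using \<open>d > 0\<close> pi_less_4 by simp
  also have "\<dots> \<le> e\<^sup>2 / 4" by (simp add: d_def power2_eq_square)
  finally have "(LINT x|period_measure. (norm ((h x - u x) + (u x - w x)))\<^sup>2) < e\<^sup>2"
    using L2_space_add(2)[OF L2_space_diff[OF h trig_polys_L2[OF u(1)]] uw] u(2) by linarith
  then have "L2_norm (\<lambda>x. h x - w x) < e"
    using \<open>e > 0\<close> unfolding L2_norm_def by (simp add: real_less_lsqrt)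
  then show "\<exists>w\<in>complex_span S. L2_norm (\<lambda>x. h x - w x) < e" using w(1) by blast
qed

section \<open>Passage from one period to the whole line\<close>

lemma periodic_2pi_int:
  assumes "periodic_2pi f" shows "f (x + 2 * pi * of_int k) = f x"
proof (induction k rule: int_induct[of _ 0])
  case (step1 i)
  then show ?case using assms[unfolded periodic_2pi_def, rule_format, of "x + 2 * pi * of_int i"]
    by (simp add: algebra_simps)
next
  case (step2 i)
  then show ?case using assms[unfolded periodic_2pi_def, rule_format, of "x + 2 * pi * of_int (i - 1)"]
    by (simp add: algebra_simps)
qed simp

text \<open>The exceptional set is covered by countably many translates of a null set. The point -pi
  is adjoined because translates of the open period by multiples of 2 pi miss the odd multiples of
  pi.\<close>

lemma periodic_AE_eq:
  assumes f: "periodic_2pi f" and g: "periodic_2pi g" and eq: "AE x in period_measure. f x = g x"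
  shows "AE x in lebesgue. f x = g x"
proof -
  have "AE x in lebesgue. x \<in> {-pi<..<pi} \<longrightarrow> f x = g x"
    using eq by (subst (asm) AE_restrict_space_iff) auto
  then obtain N where N: "N \<in> null_sets lebesgue" "{x. \<not> (x \<in> {-pi<..<pi} \<longrightarrow> f x = g x)} \<subseteq> N"
    unfolding eventually_ae_filter by auto
  have "negligible (insert (-pi) N)"
    using N(1) by (simp add: negligible_insert negligible_iff_null_sets)
  then have "(+) (2 * pi * of_int k) ` insert (-pi) N \<in> null_sets lebesgue" for k :: int
    unfolding negligible_iff_null_sets[symmetric] by (rule negligible_translation)
  then have "(\<Union>k::int. (+) (2 * pi * of_int k) ` insert (-pi) N) \<in> null_sets lebesgue"
    by (intro null_sets_UN) 
  moreover have "{x \<in> space lebesgue. f x \<noteq> g x} \<subseteq> (\<Union>k::int. (+) (2 * pi * of_int k) ` insert (-pi) N)"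
  proof
    fix x assume "x \<in> {x \<in> space lebesgue. f x \<noteq> g x}"
    then have ne: "f x \<noteq> g x" by simp
    \<comment> \<open>The number of periods by which \<open>x\<close> must be shifted back to land
      in [-pi, pi).\<close>
    define k where "k = \<lfloor>(x + pi) / (2 * pi)\<rfloor>"
    define y where "y = x - 2 * pi * of_int k"
    have x: "x = 2 * pi * of_int k + y" by (simp add: y_def)
    have "of_int k \<le> (x + pi) / (2 * pi)" "(x + pi) / (2 * pi) < of_int k + 1"
      unfolding k_def by linarith+
    then have "2 * pi * of_int k \<le> x + pi" "x + pi < 2 * pi * (of_int k + 1)"
      by (simp_all add: pos_le_divide_eq pos_divide_less_eq mult.commute)
    then have "-pi \<le> y" "y < pi" by (simp_all add: y_def algebra_simps)
    moreover have "f y \<noteq> g y"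
      using ne periodic_2pi_int[OF f, of y k] periodic_2pi_int[OF g, of y k] by (simp add: x add.commute)
    ultimately have "y \<in> insert (-pi) N" using N(2) by (cases "y = -pi") auto
    then show "x \<in> (\<Union>k::int. (+) (2 * pi * of_int k) ` insert (-pi) N)" using x by blast
  qed
  ultimately show ?thesis by (intro AE_I'[of "\<Union>k::int. (+) (2 * pi * of_int k) ` insert (-pi) N"])
qed

theorem theorem3:
  fixes c\<^sub>0 \<delta> :: real and f :: "real \<Rightarrow> complex"
  assumes "c\<^sub>0 > 0" and "c\<^sub>0\<^sup>2 = exp (1 / c\<^sub>0\<^sup>2)"
    and "\<delta> > (6 * c\<^sub>0\<^sup>2 + 2) / (3 * c\<^sub>0 ^ 3)"
    and "periodic_2pi f"
    and "integrable period_measure f"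
    and "\<exists>C::real. C > 0 \<and> (\<forall>k::int.
           0 < norm (LINT x|period_measure. f x * exp (- \<i> * of_int k * of_real x)) \<and>
           norm (LINT x|period_measure. f x * exp (- \<i> * of_int k * of_real x))
             \<le> C * exp (- \<delta> * of_int \<bar>k\<bar>))"
  shows "\<exists>g. smooth_periodic_version f g \<and>
             complete_in_L2 (range (\<lambda>n. nth_derivative n g))"
proof -
  have "(6 * c\<^sub>0\<^sup>2 + 2) / (3 * c\<^sub>0 ^ 3) > 0" using assms(1) by (intro divide_pos_pos add_nonneg_pos) auto
  with assms(3) have \<delta>: "\<delta> > 0" by linarith
  define I where "I k = (LINT x|period_measure. f x * exp (- \<i> * of_int k * of_real x))" for k :: int
  define a where "a k = I k / (2 * pi)" for k
  obtain C where "C > 0" and I: "\<And>k. 0 < norm (I k)" "\<And>k. norm (I k) \<le> C * exp (- \<delta> * of_int \<bar>k\<bar>)"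
    using assms(6) unfolding I_def by blast
  have a0: "a k \<noteq> 0" for k using I(1)[of k] by (simp add: a_def)
  have a: "norm (a k) \<le> C / (2 * pi) * exp (- \<delta> * \<bar>of_int k\<bar>)" for k
    using I(2)[of k] by (simp add: a_def norm_divide divide_right_mono)
  let ?g = "trig_series a 0"
  note [simp] = nth_derivative_trig_series[OF \<delta> a]
  have gm: "?g \<in> borel_measurable period_measure"
    by (rule continuous_period_measurable[OF trig_series_continuous[OF \<delta> a]])
  have gi: "integrable period_measure ?g"
    by (rule integrable_period_bounded[OF gm norm_trig_series_le[OF \<delta> a]])
  have "AE x in period_measure. f x - ?g x = 0"
  proof (rule Fourier_coeffs_zero_imp_AE_zero)
    show "integrable period_measure (\<lambda>x. f x - ?g x)" using assms(5) gi by simp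
    fix k :: int
    have cm: "(\<lambda>x. cis (of_int k * x)) \<in> borel_measurable period_measure"
      by (intro continuous_period_measurable trig_polys_continuous cis_in_trig_polys)
    have i: "integrable period_measure (\<lambda>x. F x * cis (of_int k * x))"
      if F: "integrable period_measure F" for F :: "real \<Rightarrow> complex"
      using F cm by (intro Bochner_Integration.integrable_bound[OF F]) (auto simp: norm_mult)
    \<comment> \<open>The uniqueness lemma tests with e^{ikx}, the coefficients with e^{-ikx}; hence
      the change of sign in the index.\<close>
    have "(LINT x|period_measure. f x * cis (of_int k * x)) = I (- k)"
      by (simp add: I_def cis_conv_exp mult_ac)
    also have "I (- k) = 2 * pi * a (- k)" by (simp add: a_def)
    also have "\<dots> = (LINT x|period_measure. ?g x * cis (of_int k * x))"
      using trig_series_Fourier_coeff[OF \<delta> a, of "- k"] by simp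
    finally show "(LINT x|period_measure. (f x - ?g x) * cis (of_int k * x)) = 0"
      using i[OF assms(5)] i[OF gi] by (simp add: left_diff_distrib)
  qed
  then have "AE x in period_measure. f x = ?g x" by simp
  then have "AE x in lebesgue. f x = ?g x"
    by (rule periodic_AE_eq[OF assms(4) trig_series_periodic[OF \<delta> a]])
  then have "smooth_periodic_version f ?g"
    using trig_series_periodic[OF \<delta> a] trig_series_smooth[OF \<delta> a]
    by (simp add: smooth_periodic_version_def)
  moreover have "complete_in_L2 (range (trig_series a))"
  proof (rule complete_in_L2_if_approx_exponentials)
    fix m :: int and e :: real assume "e > 0"
    \<comment> \<open>The tolerance is scaled by |a_m|, so that division by the nonzero a_m leaves
      exactly \<open>e\<close>.\<close>
    then have "e * norm (a m) > 0" using a0 by simp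
    from derivative_span_approx_exponential[OF \<delta> a this, of m] obtain w where
      w: "w \<in> complex_span (range (trig_series a))"
        "\<And>x. norm (a m * cis (of_int m * x) - w x) \<le> e * norm (a m)" by blast
    have "norm (cis (of_int m * x) - (1 / a m) * w x) \<le> e" for x
    proof -
      have "cis (of_int m * x) - (1 / a m) * w x = (a m * cis (of_int m * x) - w x) / a m"
        using a0 by (simp add: field_simps)
      then show ?thesis using w(2)[of x] a0[of m] by (simp add: norm_divide divide_le_eq)
    qed
    then show "\<exists>w\<in>complex_span (range (trig_series a)). \<forall>x. norm (cis (of_int m * x) - w x) \<le> e"
      using complex_span_scale[OF w(1), of "1 / a m"] by (intro bexI[of _ "\<lambda>x. (1 / a m) * w x"]) auto
  qed (use trig_series_L2[OF \<delta> a] trig_series_continuous[OF \<delta> a] in auto)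
  ultimately show ?thesis by (intro exI[of _ ?g]) simp
qed

end
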